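(* Let $n=3$, $s_0,s_1,s_2\in\mathbb{R}$ and $b_2>\frac12$. Assume $s_0+s_1+s_2\ge\frac32$ and $s_0+s_1+s_2\ge\max(s_0,s_1,s_2)$, and that these two inequalities are not both equalities. Then $\begin{pmatrix} s_0 & s_1 & s_2\\ 0 & 0 & b_2\end{pmatrix}$ is a product.
   Context: For $u\in\mathcal S(\mathbb{R}^{1+n})$ let $\widetilde u(\tau,\xi)=\iint e^{-i(t\tau+x\cdot\xi)}u(t,x)\,dt\,dx$, $(\tau,\xi)\in\mathbb{R}\times\mathbb{R}^n$, and $\langle x\rangle=(1+|x|^2)^{1/2}$. For $s,b\in\mathbb{R}$ the wave-Sobolev space $H^{s,b}=H^{s,b}(\mathbb{R}^{1+n})$ is the completion of $\mathcal S(\mathbb{R}^{1+n})$ with respect to the norm $\|u\|_{H^{s,b}}=\|\langle\xi\rangle^s\langle|\tau|-|\xi|\rangle^b\widetilde u(\tau,\xi)\|_{L^2_{\tau,\xi}}$. A real matrix $\begin{pmatrix} s_0 & s_1 & s_2\\ b_0 & b_1 & b_2\end{pmatrix}$ is called a product (in dimension $n$) if there is a constant $C$ such that $\|uv\|_{H^{-s_0,-b_0}}\le C\|u\|_{H^{s_1,b_1}}\|v\|_{H^{s_2,b_2}}$ for all $u,v\in\mathcal S(\mathbb{R}^{1+n})$. *)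

theory Defs
  imports "HOL-Analysis.Analysis"
begin

inductive_set derivs :: "('a::euclidean_space \<Rightarrow> complex) \<Rightarrow> ('a \<Rightarrow> complex) set"
  for f :: "'a \<Rightarrow> complex" where
  self: "f \<in> derivs f"
| step: "g \<in> derivs f \<Longrightarrow> (\<forall>z. g differentiable (at z)) \<Longrightarrow> v \<in> Basis \<Longrightarrow>
          (\<lambda>z. frechet_derivative g (at z) v) \<in> derivs f"

definition schwartz :: "('a::euclidean_space \<Rightarrow> complex) \<Rightarrow> bool" where
  "schwartz f \<longleftrightarrow> (\<forall>g \<in> derivs f. (\<forall>z. g differentiable (at z)) \<and>
      (\<forall>N::nat. bounded (range (\<lambda>z. (1 + norm z) ^ N * norm (g z)))))"

definition jbr :: "'a::real_normed_vector \<Rightarrow> real" where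
  "jbr x = sqrt (1 + (norm x)\<^sup>2)"

definition ft :: "(real \<times> (real^'n) \<Rightarrow> complex) \<Rightarrow> real \<times> (real^'n) \<Rightarrow> complex" where
  "ft u = (\<lambda>(\<tau>, \<xi>). integral\<^sup>L lborel
      (\<lambda>(t, x). cis (- (t * \<tau> + x \<bullet> \<xi>)) * u (t, x)))"

definition hsb_norm :: "real \<Rightarrow> real \<Rightarrow> (real \<times> (real^'n) \<Rightarrow> complex) \<Rightarrow> real" where
  "hsb_norm s b u = sqrt (enn2real (\<integral>\<^sup>+ p. ennreal
      ((jbr (snd p) powr s * jbr (\<bar>fst p\<bar> - norm (snd p)) powr b * cmod (ft u p))\<^sup>2) \<partial>lborel))"

definition is_product :: "'n::finite itself \<Rightarrow> real \<Rightarrow> real \<Rightarrow> real \<Rightarrow> real \<Rightarrow> real \<Rightarrow> real \<Rightarrow> bool" where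
  "is_product _ s0 s1 s2 b0 b1 b2 \<longleftrightarrow>
     (\<exists>C. \<forall>u v :: real \<times> (real^'n) \<Rightarrow> complex. schwartz u \<longrightarrow> schwartz v \<longrightarrow>
        hsb_norm (-s0) (-b0) (\<lambda>z. u z * v z) \<le> C * hsb_norm s1 b1 u * hsb_norm s2 b2 v)"

end

(* As b0 = b1 = 0 and b2 > 1/2, the Cauchy-Schwarz inequality in the time frequency (the weight
   <|tau|-|xi|>^(-b2) is square integrable in tau, uniformly in xi) puts the transform of v in
   L^2_xi L^1_tau, and Minkowski's and Young's inequalities in tau reduce the claim to the Sobolev product
   law H^s1 * H^s2 -> H^(-s0) on R^n, stated for convolutions. There split according to which of
   xi, xi - eta, eta is smallest. The other two are then comparable, and one application of the
   Cauchy-Schwarz inequality bounds the convolution as soon as the integral of <y>^(-2r) over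
   <y> <= R is O(R^(2 delta)), where r is the exponent of the smallest frequency and delta the sum of
   the other two; the hypotheses say precisely that this holds in all three regions. *)
theory Submission
  imports Defs "HOL-Probability.Characteristic_Functions"
begin

section \<open>Integrals of powers of the Japanese bracket\<close>

text \<open>Write S for s0 + s1 + s2 and n for the dimension. If c is the exponent of the smallest
  frequency, the two comparable ones, of size R, contribute R^(-2(S - c)), which the integral of
  <y>^(-2c) over <y> <= R has to compensate. That integral is O(R^(2(S - c))) exactly when S >= c, S
  >= n/2 and not S = c = n/2, the case in which a factor log R appears; this is where the exclusion
  of simultaneous equality comes from. The estimates between frequency functions are carried out in
  \<open>ennreal\<close> and so apply to arbitrary measurable functions. Two obstacles lie between
  them and the definitions. The transform of a product must be bounded by a convolution, which takes
  an inversion formula, proved by Gaussian regularisation. And \<open>enn2real\<close> turns an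
  infinite norm into 0, so the norms on the right must be shown to be finite, which takes rapid
  decay of transforms of Schwartz functions.\<close>

lemma nn_integral_lborel_affine:
  fixes f :: "'a::euclidean_space \<Rightarrow> ennreal"
  assumes [measurable]: "f \<in> borel_measurable borel" and "c \<noteq> 0"
  shows "(\<integral>\<^sup>+x. f x \<partial>lborel) = ennreal (\<bar>c\<bar> ^ DIM('a)) * (\<integral>\<^sup>+x. f (t + c *\<^sub>R x) \<partial>lborel)"
  by (subst lborel_affine[OF \<open>c \<noteq> 0\<close>, of t]) (simp add: nn_integral_density nn_integral_distr nn_integral_cmult)

lemma nn_integral_lborel_shift:
  fixes f :: "'a::euclidean_space \<Rightarrow> ennreal"
  assumes "f \<in> borel_measurable borel"
  shows "(\<integral>\<^sup>+x. f (x - t) \<partial>lborel) = (\<integral>\<^sup>+x. f x \<partial>lborel)"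
  using nn_integral_lborel_affine[OF assms, of 1 "-t"] by simp

lemma nn_integral_lborel_reflect:
  fixes f :: "'a::euclidean_space \<Rightarrow> ennreal"
  assumes "f \<in> borel_measurable borel"
  shows "(\<integral>\<^sup>+x. f (t - x) \<partial>lborel) = (\<integral>\<^sup>+x. f x \<partial>lborel)"
  using nn_integral_lborel_affine[OF assms, of "-1" t] by simp

lemma jbr_ge_1: "jbr x \<ge> 1"
  by (simp add: jbr_def)

lemma jbr_pos: "jbr x > 0"
  using jbr_ge_1[of x] by linarith

text \<open>A simp rule because \<open>x powr 0\<close> is 1 only for nonzero \<open>x\<close>;
  cancelling opposite exponents and erasing weights of exponent 0 rely on it.\<close>

lemma jbr_nonzero [simp]: "jbr x \<noteq> 0"
  using jbr_pos[of x] by simp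

lemma norm_le_jbr: "norm x \<le> jbr x"
  unfolding jbr_def by (rule real_le_rsqrt) simp

lemma jbr_le: "jbr x \<le> 1 + norm x"
  unfolding jbr_def by (rule real_le_lsqrt) (auto simp: power2_eq_square algebra_simps)

lemma jbr_minus: "jbr (- x) = jbr x"
  by (simp add: jbr_def)

lemma jbr_minus_commute: "jbr (x - y) = jbr (y - x)"
  by (simp add: jbr_def norm_minus_commute)

lemma jbr_mono: "norm x \<le> norm y \<Longrightarrow> jbr x \<le> jbr y"
  by (simp add: jbr_def power_mono)

lemma jbr_measurable [measurable]: "jbr \<in> borel_measurable borel"
  unfolding jbr_def by measurable

text \<open>\<open>jbr z\<close> is the Euclidean norm of \<open>(1, z)\<close>. Adding
  \<open>(0, y)\<close> rather than \<open>(1, y)\<close> keeps the first entry equal to 1.\<close>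

lemma jbr_triangle: "jbr (x + y) \<le> jbr x + jbr y"
proof -
  have "jbr z = norm (1::real, z)" for z :: 'a
    by (simp add: jbr_def norm_Pair)
  then have "jbr (x + y) \<le> jbr x + norm (0::real, y)"
    using norm_triangle_ineq[of "(1::real, x)" "(0, y)"] by simp
  also have "norm (0::real, y) \<le> jbr y"
    using norm_le_jbr by (simp add: norm_Pair)
  finally show ?thesis by simp
qed

lemma jbr_component: "b \<in> Basis \<Longrightarrow> jbr (x \<bullet> b) \<le> jbr x"
  by (rule jbr_mono) (simp add: Basis_le_norm)

text \<open>Stands in for polar coordinates: the weight splits into one-dimensional factors that
  Tonelli integrates separately. Spreading the exponent evenly keeps the sharp threshold, since the
  total exceeds the dimension exactly when each share exceeds 1.\<close>

lemma jbr_powr_le_prod: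
  fixes x :: "'a::euclidean_space"
  assumes "p \<ge> 0"
  shows "jbr x powr (- (real DIM('a) * p)) \<le> (\<Prod>b\<in>Basis. jbr (x \<bullet> b) powr (- p))"
proof -
  have "jbr x powr (- (real DIM('a) * p)) = (\<Prod>b\<in>(Basis::'a set). jbr x powr (- p))"
    using jbr_pos[of x] by (simp add: powr_realpow[symmetric] powr_powr mult.commute)
  also have "\<dots> \<le> (\<Prod>b\<in>Basis. jbr (x \<bullet> b) powr (- p))"
    by (intro prod_mono conjI powr_mono2') (use assms jbr_pos jbr_component in auto)
  finally show ?thesis .
qed

lemma nn_integral_jbr_finite:
  fixes q :: real
  assumes "q > 1"
  shows "\<exists>C\<ge>0. (\<integral>\<^sup>+t. ennreal (jbr (t::real) powr (- q)) \<partial>lborel) \<le> ennreal C"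
proof -
  define f :: "real \<Rightarrow> ennreal" where "f t = ennreal (t powr (- q)) * indicator {1..} t" for t
  have [measurable]: "f \<in> borel_measurable borel"
    unfolding f_def by measurable
  have tail: "(\<integral>\<^sup>+t. f t \<partial>lborel) = ennreal (1 / (q - 1))"
    unfolding f_def
  proof (rule nn_integral_has_integral_lebesgue')
    have "- (1 powr (- q + 1)) / (- q + 1) = 1 / (q - 1)"
      using assms by (simp add: divide_simps)
    then show "((\<lambda>t. t powr (- q)) has_integral 1 / (q - 1)) {1..}"
      using has_integral_powr_to_inf[of "- q" 1] assms by simp
  qed simp
  have tail': "(\<integral>\<^sup>+t. f (- t) \<partial>lborel) = ennreal (1 / (q - 1))"
    using nn_integral_lborel_reflect[of f 0] tail by simp
  have pt: "ennreal (jbr t powr (- q)) \<le> indicator {-1..1} t + f t + f (- t)" for t :: real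
  proof -
    have "jbr t powr (- q) \<le> 1"
      using powr_mono[of "- q" 0 "jbr t"] jbr_ge_1[of t] assms by simp
    moreover have "jbr t powr (- q) \<le> \<bar>t\<bar> powr (- q)" if "\<bar>t\<bar> \<ge> 1"
      by (rule powr_mono2') (use that assms norm_le_jbr[of t] in auto)
    ultimately consider "- 1 \<le> t" "t \<le> 1" "jbr t powr (- q) \<le> 1" | "t > 1" "jbr t powr (- q) \<le> t powr (- q)"
      | "t < - 1" "jbr t powr (- q) \<le> (- t) powr (- q)" by fastforce
    then show ?thesis
    proof cases
      case 1
      then have "ennreal (jbr t powr (- q)) \<le> indicator {-1..1} t" by simp
      then show ?thesis by (simp add: add_increasing2)
    qed (simp_all add: f_def ennreal_leI)
  qed
  have "(\<integral>\<^sup>+t. ennreal (jbr (t::real) powr (- q)) \<partial>lborel) \<le> (\<integral>\<^sup>+t. (indicator {-1..1} t + f t + f (- t)) \<partial>lborel)"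
    by (intro nn_integral_mono pt)
  also have "\<dots> = ennreal 2 + ennreal (1/(q-1)) + ennreal (1/(q-1))"
    by (simp add: nn_integral_add tail tail')
  also have "\<dots> = ennreal (2 + 1/(q-1) + 1/(q-1))"
    using assms by (subst ennreal_plus[symmetric], simp, simp)+ simp
  finally show ?thesis using assms by (intro exI[of _ "2 + 1/(q-1) + 1/(q-1)"]) auto
qed

lemma nn_integral_jbr_finite_euclidean:
  fixes q :: real
  assumes "q > DIM('a)"
  shows "\<exists>C\<ge>0. (\<integral>\<^sup>+y. ennreal (jbr (y::'a::euclidean_space) powr (- q)) \<partial>lborel) \<le> ennreal C"
proof -
  define e where "e = q / DIM('a)"
  have e: "e > 1" "q = real DIM('a) * e"
    using assms by (simp_all add: e_def)
  obtain J where J: "J \<ge> 0" "(\<integral>\<^sup>+t. ennreal (jbr (t::real) powr (- e)) \<partial>lborel) \<le> ennreal J"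
    using nn_integral_jbr_finite[OF e(1)] by blast
  have "(\<integral>\<^sup>+y. ennreal (jbr (y::'a) powr (- q)) \<partial>lborel) \<le> (\<integral>\<^sup>+y. (\<Prod>b\<in>Basis. ennreal (jbr ((y::'a) \<bullet> b) powr (- e))) \<partial>lborel)"
    using jbr_powr_le_prod[of e, where 'a='a] e by (intro nn_integral_mono) (simp add: prod_ennreal ennreal_leI)
  also have "\<dots> = (\<Prod>b\<in>(Basis::'a set). (\<integral>\<^sup>+t. ennreal (jbr (t::real) powr (- e)) \<partial>lborel))"
    by (subst nn_integral_lborel_prod) auto
  also have "\<dots> \<le> (\<Prod>b\<in>(Basis::'a set). ennreal J)"
    using J(2) by (intro prod_mono_ennreal)
  also have "\<dots> = ennreal (J ^ DIM('a))"
    using J(1) by (simp add: ennreal_power)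
  finally show ?thesis using J(1) by (intro exI[of _ "J ^ DIM('a)"]) auto
qed

text \<open>The exponent e - 1 lies between -1 and 0, so replacing \<open>jbr t\<close> by the
  smaller |t| enlarges the integrand to a power that is still integrable at the origin; each side of
  the origin gives R^e / e.\<close>

lemma nn_integral_jbr_truncated:
  fixes e R :: real
  assumes "0 < e" "e < 1" "R > 0"
  shows "(\<integral>\<^sup>+t. ennreal (jbr (t::real) powr (e - 1)) * indicator {t. jbr t \<le> R} t \<partial>lborel)
     \<le> ennreal (2 / e * R powr e)"
proof -
  define f :: "real \<Rightarrow> ennreal" where "f t = ennreal (t powr (e - 1)) * indicator {0..R} t" for t
  have [measurable]: "f \<in> borel_measurable borel"
    unfolding f_def by measurable
  have part: "(\<integral>\<^sup>+t. f t \<partial>lborel) = ennreal (R powr e / e)"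
    unfolding f_def using has_integral_powr_from_0[of "e - 1" R] assms
    by (intro nn_integral_has_integral_lebesgue') auto
  have part': "(\<integral>\<^sup>+t. f (- t) \<partial>lborel) = ennreal (R powr e / e)"
    using nn_integral_lborel_reflect[of f 0] part by simp
  \<comment> \<open>The origin is left out because \<open>0 powr (e - 1)\<close> is 0 in HOL, so the
    comparison can fail there.\<close>
  have pt: "ennreal (jbr t powr (e - 1)) * indicator {t. jbr t \<le> R} t \<le> f t + f (- t)"
    if nz: "t \<noteq> 0" for t :: real
  proof -
    have "jbr t powr (e - 1) \<le> \<bar>t\<bar> powr (e - 1)"
      by (rule powr_mono2') (use nz assms norm_le_jbr[of t] in auto)
    then have le: "ennreal (jbr t powr (e - 1)) \<le> ennreal (\<bar>t\<bar> powr (e - 1))"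
      by (rule ennreal_leI)
    have "\<bar>t\<bar> \<le> R" if "jbr t \<le> R"
      using that norm_le_jbr[of t] by simp
    then show ?thesis
      using le nz by (cases "jbr t \<le> R"; cases "t > 0") (simp_all add: f_def indicator_def)
  qed
  have "(\<integral>\<^sup>+t. ennreal (jbr (t::real) powr (e - 1)) * indicator {t. jbr t \<le> R} t \<partial>lborel) \<le> (\<integral>\<^sup>+t. (f t + f (- t)) \<partial>lborel)"
  proof (rule nn_integral_mono_AE)
    show "AE t in lborel. ennreal (jbr (t::real) powr (e - 1)) * indicator {t. jbr t \<le> R} t \<le> f t + f (- t)"
      using AE_lborel_singleton[of "0::real"] by eventually_elim (rule pt)
  qed
  also have "\<dots> = ennreal (R powr e / e) + ennreal (R powr e / e)"
    by (simp add: nn_integral_add part part')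
  also have "\<dots> = ennreal (2 / e * R powr e)"
    using assms by (subst ennreal_plus[symmetric]) auto
  finally show ?thesis .
qed

text \<open>For \<delta> = 0 the hypotheses force 2 r > \<open>DIM('a)\<close>, and the integral
  over the whole space converges. For \<delta> > 0 the ball is enlarged to a cube, and the weight is
  split into a power of <y> that is bounded by its value at R and a product of truncated
  one-dimensional weights.\<close>

lemma nn_integral_jbr_ball:
  fixes \<delta> r :: real
  assumes "\<delta> \<ge> 0" "\<delta> + r \<ge> DIM('a) / 2" "\<not> (\<delta> = 0 \<and> r = DIM('a) / 2)"
  shows "\<exists>C\<ge>0. \<forall>R\<ge>1. (\<integral>\<^sup>+y. ennreal (jbr (y::'a::euclidean_space) powr (- 2 * r)) * indicator {y. jbr y \<le> R} y \<partial>lborel)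
     \<le> ennreal (C * R powr (2 * \<delta>))"
proof (cases "\<delta> = 0")
  case True
  then have "2 * r > DIM('a)"
    using assms by auto
  then obtain J where J: "J \<ge> 0" "(\<integral>\<^sup>+y. ennreal (jbr (y::'a) powr (- (2 * r))) \<partial>lborel) \<le> ennreal J"
    using nn_integral_jbr_finite_euclidean by blast
  have "(\<integral>\<^sup>+y. ennreal (jbr (y::'a) powr (- 2 * r)) * indicator {y. jbr y \<le> R} y \<partial>lborel)
     \<le> ennreal (J * R powr (2 * \<delta>))" if "R \<ge> 1" for R
  proof -
    have "(\<integral>\<^sup>+y. ennreal (jbr (y::'a) powr (- 2 * r)) * indicator {y. jbr y \<le> R} y \<partial>lborel)
      \<le> (\<integral>\<^sup>+y. ennreal (jbr (y::'a) powr (- (2 * r))) \<partial>lborel)"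
      by (intro nn_integral_mono) (auto simp: indicator_def)
    then show ?thesis
      using J(2) True that by simp
  qed
  then show ?thesis using J by blast
next
  case False
  define n where "n = real DIM('a)"
  have n: "n > 0" by (simp add: n_def)
  \<comment> \<open>Only the part d of \<delta> is spent on the coordinate integrals; the cap n / 4
    keeps e at most 1/2, so \<open>nn_integral_jbr_truncated\<close> applies however large \<delta>
    is. With e = 2 d / n the n factors R^e multiply to R^(2 d).\<close>
  define d where "d = min \<delta> (n / 4)"
  have d: "d > 0" "d \<le> \<delta>" "d \<le> n / 4" using False assms(1) n by (auto simp: d_def)
  define e where "e = 2 * d / n"
  have e: "0 < e" "e < 1" using d n by (auto simp: e_def field_simps)
  have "(\<integral>\<^sup>+y. ennreal (jbr (y::'a) powr (- 2 * r)) * indicator {y. jbr y \<le> R} y \<partial>lborel)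
     \<le> ennreal ((2 / e) ^ DIM('a) * R powr (2 * \<delta>))" if R: "R \<ge> 1" for R
  proof -
    have "(\<integral>\<^sup>+y. ennreal (jbr (y::'a) powr (- 2 * r)) * indicator {y. jbr y \<le> R} y \<partial>lborel)
      \<le> (\<integral>\<^sup>+y. ennreal (R powr (2 * (\<delta> - d))) * (\<Prod>b\<in>Basis. ennreal (jbr ((y::'a) \<bullet> b) powr (e - 1)) * indicator {t. jbr t \<le> R} (y \<bullet> b)) \<partial>lborel)"
    proof (intro nn_integral_mono)
      fix y :: 'a
      show "ennreal (jbr y powr (- 2 * r)) * indicator {y. jbr y \<le> R} y \<le>
           ennreal (R powr (2 * (\<delta> - d))) * (\<Prod>b\<in>Basis. ennreal (jbr (y \<bullet> b) powr (e - 1)) * indicator {t. jbr t \<le> R} (y \<bullet> b))"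
      proof (cases "jbr y \<le> R")
        case True
        have comp: "jbr (y \<bullet> b) \<le> R" if "b \<in> Basis" for b
          using jbr_component[OF that, of y] True by linarith
        \<comment> \<open>Here \<delta> + r >= n / 2 enters: n (1 - e) = n - 2 d, so the exponent on
          the right is 2 \<delta> - n.\<close>
        have "jbr y powr (- 2 * r) \<le> jbr y powr (2 * (\<delta> - d) + - (n * (1 - e)))"
          using assms(2) n jbr_ge_1[of y] by (intro powr_mono) (auto simp: e_def n_def field_simps)
        also have "\<dots> = jbr y powr (2 * (\<delta> - d)) * jbr y powr (- (n * (1 - e)))"
          by (rule powr_add)
        also have "\<dots> \<le> R powr (2 * (\<delta> - d)) * (\<Prod>b\<in>Basis. jbr (y \<bullet> b) powr (- (1 - e)))"
          using jbr_powr_le_prod[of "1 - e" y] e d True jbr_pos[of y]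
          by (intro mult_mono powr_mono2) (auto simp: n_def)
        finally have "jbr y powr (- 2 * r) \<le> R powr (2 * (\<delta> - d)) * (\<Prod>b\<in>Basis. jbr (y \<bullet> b) powr (e - 1))"
          by simp
        then show ?thesis
          using True comp by (simp add: prod_ennreal ennreal_mult[symmetric] prod_nonneg ennreal_leI)
      qed simp
    qed
    also have "\<dots> = ennreal (R powr (2 * (\<delta> - d))) * (\<Prod>b\<in>(Basis::'a set). (\<integral>\<^sup>+t. ennreal (jbr (t::real) powr (e - 1)) * indicator {t. jbr t \<le> R} t \<partial>lborel))"
      by (subst nn_integral_cmult, measurable) (subst nn_integral_lborel_prod, auto)
    also have "\<dots> \<le> ennreal (R powr (2 * (\<delta> - d))) * (\<Prod>b\<in>(Basis::'a set). ennreal (2 / e * R powr e))"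
      using nn_integral_jbr_truncated[OF e, of R] R by (intro mult_left_mono prod_mono_ennreal) auto
    also have "\<dots> = ennreal (R powr (2 * (\<delta> - d)) * (2 / e * R powr e) ^ DIM('a))"
      using e R by (simp add: ennreal_power ennreal_mult[symmetric])
    also have "(2 / e * R powr e) ^ DIM('a) = (2 / e) ^ DIM('a) * R powr (n * e)"
      using R powr_realpow[of "R powr e" "DIM('a)"]
      by (simp only: power_mult_distrib) (simp add: powr_powr n_def mult.commute)
    also have "R powr (2 * (\<delta> - d)) * ((2 / e) ^ DIM('a) * R powr (n * e)) = (2 / e) ^ DIM('a) * (R powr (2 * (\<delta> - d)) * R powr (n * e))"
      by simp
    also have "R powr (2 * (\<delta> - d)) * R powr (n * e) = R powr (2 * \<delta>)"
      using n by (simp add: powr_add[symmetric] e_def)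
    finally show ?thesis .
  qed
  then show ?thesis using e by (intro exI[of _ "(2 / e) ^ DIM('a)"]) auto
qed

section \<open>The Sobolev product law on the Fourier side\<close>

lemma ennreal_power2_le_imp_le:
  fixes a b :: ennreal
  assumes "a\<^sup>2 \<le> b\<^sup>2"
  shows "a \<le> b"
proof (cases b)
  case (real r)
  then have "a \<noteq> top" using assms by (auto simp: ennreal_power top_unique)
  then obtain s where s: "a = ennreal s" "s \<ge> 0" by (cases a) auto
  with assms real have "s\<^sup>2 \<le> r\<^sup>2" by (simp add: ennreal_power)
  then have "s \<le> r" using real by (rule_tac power2_le_imp_le) auto
  then show ?thesis using s real by (simp add: ennreal_leI)
qed simp

text \<open>Comparison with three times the largest summand; the resulting 9 instead of the sharp 3
  only enlarges the final constant.\<close>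

lemma ennreal_power2_sum3:
  fixes a b c :: ennreal
  shows "(a + b + c)\<^sup>2 \<le> 9 * (a\<^sup>2 + b\<^sup>2 + c\<^sup>2)"
proof -
  define m where "m = max a (max b c)"
  have "a + b + c \<le> m + m + m"
    by (intro add_mono) (simp_all add: m_def le_max_iff_disj)
  also have "\<dots> = (1 + 1 + 1) * m"
    by (simp only: distrib_right mult_1)
  also have "\<dots> = 3 * m"
    by simp
  finally have "(a + b + c)\<^sup>2 \<le> (3 * m)\<^sup>2"
    by (rule power_mono) simp
  also have "\<dots> = 9 * m\<^sup>2"
    by (simp add: power_mult_distrib)
  also have "m\<^sup>2 \<le> a\<^sup>2 + b\<^sup>2 + c\<^sup>2"
    by (auto simp: m_def max_def add_increasing add_increasing2)
  finally show ?thesis by (simp add: mult_left_mono)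
qed

lemma nn_integral_square_expand:
  assumes [measurable]: "f \<in> borel_measurable M"
  shows "(\<integral>\<^sup>+x. f x \<partial>M)\<^sup>2 = (\<integral>\<^sup>+x. (\<integral>\<^sup>+y. f x * f y \<partial>M) \<partial>M)"
  by (simp add: power2_eq_square nn_integral_cmult nn_integral_multc)

text \<open>Expanding the square of the inner integral and applying Cauchy-Schwarz in \<open>x\<close> avoids the division
  by a possibly vanishing norm in the usual duality proof.\<close>

lemma nn_integral_Minkowski:
  fixes \<Phi> :: "'a::euclidean_space \<Rightarrow> 'b::euclidean_space \<Rightarrow> ennreal"
  assumes [measurable]: "(\<lambda>(x, y). \<Phi> x y) \<in> borel_measurable (borel \<Otimes>\<^sub>M borel)" "A \<in> borel_measurable borel"
    and bound: "\<And>y. (\<integral>\<^sup>+x. (\<Phi> x y)\<^sup>2 \<partial>lborel) \<le> (A y)\<^sup>2"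
  shows "(\<integral>\<^sup>+x. (\<integral>\<^sup>+y. \<Phi> x y \<partial>lborel)\<^sup>2 \<partial>lborel) \<le> (\<integral>\<^sup>+y. A y \<partial>lborel)\<^sup>2"
proof -
  have pair: "(\<integral>\<^sup>+x. \<Phi> x y * \<Phi> x z \<partial>lborel) \<le> A y * A z" for y z
  proof (rule ennreal_power2_le_imp_le)
    have "(\<integral>\<^sup>+x. \<Phi> x y * \<Phi> x z \<partial>lborel)\<^sup>2 \<le> (\<integral>\<^sup>+x. (\<Phi> x y)\<^sup>2 \<partial>lborel) * (\<integral>\<^sup>+x. (\<Phi> x z)\<^sup>2 \<partial>lborel)"
      by (rule Cauchy_Schwarz_nn_integral) measurable
    also have "\<dots> \<le> (A y)\<^sup>2 * (A z)\<^sup>2"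
      by (intro mult_mono bound) auto
    finally show "(\<integral>\<^sup>+x. \<Phi> x y * \<Phi> x z \<partial>lborel)\<^sup>2 \<le> (A y * A z)\<^sup>2"
      by (simp add: power_mult_distrib)
  qed
  have "(\<integral>\<^sup>+x. (\<integral>\<^sup>+y. \<Phi> x y \<partial>lborel)\<^sup>2 \<partial>lborel) = (\<integral>\<^sup>+x. \<integral>\<^sup>+y. \<integral>\<^sup>+z. \<Phi> x y * \<Phi> x z \<partial>lborel \<partial>lborel \<partial>lborel)"
    by (intro nn_integral_cong nn_integral_square_expand) measurable
  also have "\<dots> = (\<integral>\<^sup>+y. \<integral>\<^sup>+x. \<integral>\<^sup>+z. \<Phi> x y * \<Phi> x z \<partial>lborel \<partial>lborel \<partial>lborel)"
    by (rule lborel_pair.Fubini'[symmetric]) measurable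
  also have "\<dots> = (\<integral>\<^sup>+y. \<integral>\<^sup>+z. \<integral>\<^sup>+x. \<Phi> x y * \<Phi> x z \<partial>lborel \<partial>lborel \<partial>lborel)"
    by (intro nn_integral_cong lborel_pair.Fubini'[symmetric]) measurable
  also have "\<dots> \<le> (\<integral>\<^sup>+y. \<integral>\<^sup>+z. A y * A z \<partial>lborel \<partial>lborel)"
    by (intro nn_integral_mono pair)
  also have "\<dots> = (\<integral>\<^sup>+y. A y \<partial>lborel)\<^sup>2"
    by (rule nn_integral_square_expand[symmetric]) measurable
  finally show ?thesis .
qed

text \<open>Cauchy-Schwarz in y separates k from the product of f and g; the remaining double
  integral factorises by Tonelli and translation invariance. This serves the regions where y or x -
  y is smallest, since there k is square integrable in y uniformly in x.\<close>

lemma nn_integral_convolution_kernel_left: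
  fixes k :: "'a::euclidean_space \<Rightarrow> 'a \<Rightarrow> ennreal"
  assumes [measurable]: "(\<lambda>(x, y). k x y) \<in> borel_measurable (borel \<Otimes>\<^sub>M borel)"
    "f \<in> borel_measurable borel" "g \<in> borel_measurable borel"
    and bound: "\<And>x. (\<integral>\<^sup>+y. (k x y)\<^sup>2 \<partial>lborel) \<le> C"
  shows "(\<integral>\<^sup>+x. (\<integral>\<^sup>+y. k x y * (f (x - y) * g y) \<partial>lborel)\<^sup>2 \<partial>lborel)
       \<le> C * ((\<integral>\<^sup>+x. (f x)\<^sup>2 \<partial>lborel) * (\<integral>\<^sup>+x. (g x)\<^sup>2 \<partial>lborel))"
proof -
  have "(\<integral>\<^sup>+x. (\<integral>\<^sup>+y. k x y * (f (x - y) * g y) \<partial>lborel)\<^sup>2 \<partial>lborel)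
      \<le> (\<integral>\<^sup>+x. C * (\<integral>\<^sup>+y. (f (x - y) * g y)\<^sup>2 \<partial>lborel) \<partial>lborel)"
  proof (rule nn_integral_mono)
    fix x
    have "(\<integral>\<^sup>+y. k x y * (f (x - y) * g y) \<partial>lborel)\<^sup>2 \<le> (\<integral>\<^sup>+y. (k x y)\<^sup>2 \<partial>lborel) * (\<integral>\<^sup>+y. (f (x - y) * g y)\<^sup>2 \<partial>lborel)"
      by (rule Cauchy_Schwarz_nn_integral) measurable
    also have "\<dots> \<le> C * (\<integral>\<^sup>+y. (f (x - y) * g y)\<^sup>2 \<partial>lborel)"
      by (intro mult_right_mono bound) auto
    finally show "(\<integral>\<^sup>+y. k x y * (f (x - y) * g y) \<partial>lborel)\<^sup>2 \<le> C * (\<integral>\<^sup>+y. (f (x - y) * g y)\<^sup>2 \<partial>lborel)" .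
  qed
  also have "\<dots> = C * (\<integral>\<^sup>+x. \<integral>\<^sup>+y. (f (x - y))\<^sup>2 * (g y)\<^sup>2 \<partial>lborel \<partial>lborel)"
    by (simp add: nn_integral_cmult power_mult_distrib)
  also have "(\<integral>\<^sup>+x. \<integral>\<^sup>+y. (f (x - y))\<^sup>2 * (g y)\<^sup>2 \<partial>lborel \<partial>lborel)
       = (\<integral>\<^sup>+y. \<integral>\<^sup>+x. (f (x - y))\<^sup>2 * (g y)\<^sup>2 \<partial>lborel \<partial>lborel)"
    by (rule lborel_pair.Fubini'[symmetric]) measurable
  also have "\<dots> = (\<integral>\<^sup>+y. (\<integral>\<^sup>+x. (f x)\<^sup>2 \<partial>lborel) * (g y)\<^sup>2 \<partial>lborel)"
    using nn_integral_lborel_shift[of "\<lambda>x. (f x)\<^sup>2"] by (simp add: nn_integral_multc)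
  also have "\<dots> = (\<integral>\<^sup>+x. (f x)\<^sup>2 \<partial>lborel) * (\<integral>\<^sup>+x. (g x)\<^sup>2 \<partial>lborel)"
    by (simp add: nn_integral_cmult)
  finally show ?thesis .
qed

text \<open>The counterpart for the region where x itself is smallest, in which the available bound
  on k is an integral over x. Hence k stays with g in Cauchy-Schwarz, and its square is integrated
  in x after Tonelli.\<close>

lemma nn_integral_convolution_kernel_right:
  fixes k :: "'a::euclidean_space \<Rightarrow> 'a \<Rightarrow> ennreal"
  assumes [measurable]: "(\<lambda>(x, y). k x y) \<in> borel_measurable (borel \<Otimes>\<^sub>M borel)"
    "f \<in> borel_measurable borel" "g \<in> borel_measurable borel"
    and bound: "\<And>y. (\<integral>\<^sup>+x. (k x y)\<^sup>2 \<partial>lborel) \<le> C"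
  shows "(\<integral>\<^sup>+x. (\<integral>\<^sup>+y. k x y * (f (x - y) * g y) \<partial>lborel)\<^sup>2 \<partial>lborel)
       \<le> C * ((\<integral>\<^sup>+x. (f x)\<^sup>2 \<partial>lborel) * (\<integral>\<^sup>+x. (g x)\<^sup>2 \<partial>lborel))"
proof -
  define F where "F = (\<integral>\<^sup>+x. (f x)\<^sup>2 \<partial>lborel)"
  have "(\<integral>\<^sup>+x. (\<integral>\<^sup>+y. k x y * (f (x - y) * g y) \<partial>lborel)\<^sup>2 \<partial>lborel)
      \<le> (\<integral>\<^sup>+x. F * (\<integral>\<^sup>+y. (k x y)\<^sup>2 * (g y)\<^sup>2 \<partial>lborel) \<partial>lborel)"
  proof (rule nn_integral_mono)
    fix x
    have "(\<integral>\<^sup>+y. k x y * (f (x - y) * g y) \<partial>lborel)\<^sup>2 = (\<integral>\<^sup>+y. f (x - y) * (k x y * g y) \<partial>lborel)\<^sup>2"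
      by (simp add: mult_ac)
    also have "\<dots> \<le> (\<integral>\<^sup>+y. (f (x - y))\<^sup>2 \<partial>lborel) * (\<integral>\<^sup>+y. (k x y * g y)\<^sup>2 \<partial>lborel)"
      by (rule Cauchy_Schwarz_nn_integral) measurable
    also have "(\<integral>\<^sup>+y. (f (x - y))\<^sup>2 \<partial>lborel) = F"
      unfolding F_def by (rule nn_integral_lborel_reflect) measurable
    finally show "(\<integral>\<^sup>+y. k x y * (f (x - y) * g y) \<partial>lborel)\<^sup>2 \<le> F * (\<integral>\<^sup>+y. (k x y)\<^sup>2 * (g y)\<^sup>2 \<partial>lborel)"
      by (simp add: power_mult_distrib)
  qed
  also have "\<dots> = F * (\<integral>\<^sup>+x. \<integral>\<^sup>+y. (k x y)\<^sup>2 * (g y)\<^sup>2 \<partial>lborel \<partial>lborel)"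
    by (simp add: nn_integral_cmult)
  also have "(\<integral>\<^sup>+x. \<integral>\<^sup>+y. (k x y)\<^sup>2 * (g y)\<^sup>2 \<partial>lborel \<partial>lborel) = (\<integral>\<^sup>+y. \<integral>\<^sup>+x. (k x y)\<^sup>2 * (g y)\<^sup>2 \<partial>lborel \<partial>lborel)"
    by (rule lborel_pair.Fubini'[symmetric]) measurable
  also have "\<dots> = (\<integral>\<^sup>+y. (\<integral>\<^sup>+x. (k x y)\<^sup>2 \<partial>lborel) * (g y)\<^sup>2 \<partial>lborel)"
    by (simp add: nn_integral_multc)
  also have "\<dots> \<le> (\<integral>\<^sup>+y. C * (g y)\<^sup>2 \<partial>lborel)"
    by (intro nn_integral_mono mult_right_mono bound) auto
  also have "\<dots> = C * (\<integral>\<^sup>+x. (g x)\<^sup>2 \<partial>lborel)"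
    by (simp add: nn_integral_cmult)
  finally show ?thesis
    by (simp add: F_def[symmetric] mult_left_mono mult.left_commute)
qed

text \<open>The convolution kernel restricted to the region where \<open>y\<close> is the smallest of the three frequencies.\<close>

definition low_kernel :: "real \<Rightarrow> real \<Rightarrow> real \<Rightarrow> 'a::euclidean_space \<Rightarrow> 'a \<Rightarrow> ennreal" where
  "low_kernel p q r x y = (if jbr y \<le> jbr x \<and> jbr y \<le> jbr (x - y)
     then ennreal (jbr x powr (- p) * jbr (x - y) powr (- q) * jbr y powr (- r)) else 0)"

lemma low_kernel_measurable [measurable]:
  assumes [measurable]: "f \<in> borel_measurable M" "g \<in> borel_measurable M"
  shows "(\<lambda>z. low_kernel p q r (f z) (g z)) \<in> borel_measurable M"
  unfolding low_kernel_def by measurable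

text \<open>For negative q the lower bound on a is the decisive one, hence comparability in both
  directions and the absolute value in the constant.\<close>

lemma powr_comparable:
  fixes a b :: real
  assumes "a > 0" "b > 0" "a \<le> 2 * b" "b \<le> 2 * a"
  shows "a powr q \<le> 2 powr \<bar>q\<bar> * b powr q"
proof (cases "q \<ge> 0")
  case True
  then have "a powr q \<le> (2 * b) powr q" using assms by (intro powr_mono2) auto
  then show ?thesis using True assms by (simp add: powr_mult)
next
  case False
  then have "a powr q \<le> (b / 2) powr q" using assms by (intro powr_mono2') auto
  then show ?thesis using False assms by (simp add: powr_divide powr_minus_divide)
qed

text \<open>Where y has the smallest bracket, the triangle inequality gives <x> <= 2 <x - y> and <x
  - y> <= 2 <x>. So the squared kernel is at most a constant times <x>^(-2(p + q)) <y>^(-2r) on <y>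
  <= <x>, and \<open>nn_integral_jbr_ball\<close> with \<delta> = p + q and R = <x> cancels the
  first factor exactly.\<close>

lemma low_kernel_bound:
  fixes p q r :: real
  assumes "p + q \<ge> 0" "p + q + r \<ge> DIM('a) / 2" "\<not> (p + q = 0 \<and> r = DIM('a) / 2)"
  shows "\<exists>C\<ge>0. \<forall>x::'a::euclidean_space. (\<integral>\<^sup>+y. (low_kernel p q r x y)\<^sup>2 \<partial>lborel) \<le> ennreal C"
proof -
  obtain C where C: "C \<ge> 0" "\<And>R. R \<ge> 1 \<Longrightarrow> (\<integral>\<^sup>+y. ennreal (jbr (y::'a) powr (- 2 * r)) * indicator {y. jbr y \<le> R} y \<partial>lborel)
     \<le> ennreal (C * R powr (2 * (p + q)))"
    using nn_integral_jbr_ball[OF assms] by blast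
  define D where "D = (2 powr \<bar>- q\<bar>)\<^sup>2"
  have "(\<integral>\<^sup>+y. (low_kernel p q r x y)\<^sup>2 \<partial>lborel) \<le> ennreal (D * C)" for x :: 'a
  proof -
    define c where "c = D * jbr x powr (- 2 * (p + q))"
    have c: "c \<ge> 0" by (simp add: c_def D_def)
    have "(\<integral>\<^sup>+y. (low_kernel p q r x y)\<^sup>2 \<partial>lborel) \<le>
       (\<integral>\<^sup>+y. ennreal c * (ennreal (jbr (y::'a) powr (- 2 * r)) * indicator {y. jbr y \<le> jbr x} y) \<partial>lborel)"
    proof (rule nn_integral_mono)
      fix y :: 'a
      show "(low_kernel p q r x y)\<^sup>2 \<le> ennreal c * (ennreal (jbr y powr (- 2 * r)) * indicator {y. jbr y \<le> jbr x} y)"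
      proof (cases "jbr y \<le> jbr x \<and> jbr y \<le> jbr (x - y)")
        case True
        have "jbr x \<le> jbr (x - y) + jbr y" "jbr (x - y) \<le> jbr x + jbr y"
          using jbr_triangle[of "x - y" y] jbr_triangle[of x "- y"] by (simp_all add: jbr_minus)
        then have "jbr (x - y) powr (- q) \<le> 2 powr \<bar>- q\<bar> * jbr x powr (- q)"
          using True jbr_pos by (intro powr_comparable) (auto intro: order_trans)
        then have "jbr x powr (- p) * jbr (x - y) powr (- q) * jbr y powr (- r)
            \<le> jbr x powr (- p) * (2 powr \<bar>- q\<bar> * jbr x powr (- q)) * jbr y powr (- r)"
          by (intro mult_right_mono mult_left_mono) auto
        then have "(jbr x powr (- p) * jbr (x - y) powr (- q) * jbr y powr (- r))\<^sup>2
            \<le> (jbr x powr (- p) * (2 powr \<bar>- q\<bar> * jbr x powr (- q)) * jbr y powr (- r))\<^sup>2"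
          by (rule power_mono) simp
        also have "\<dots> = D * (jbr x powr (- p) * jbr x powr (- q))\<^sup>2 * (jbr y powr (- r))\<^sup>2"
          by (simp add: D_def power_mult_distrib)
        also have "\<dots> = c * jbr y powr (- 2 * r)"
          by (simp add: c_def powr_add[symmetric] power2_eq_square)
        finally show ?thesis
          using True c by (simp add: low_kernel_def ennreal_power ennreal_mult[symmetric] ennreal_leI)
      qed (auto simp: low_kernel_def)
    qed
    also have "\<dots> = ennreal c * (\<integral>\<^sup>+y. ennreal (jbr (y::'a) powr (- 2 * r)) * indicator {y. jbr y \<le> jbr x} y \<partial>lborel)"
      by (rule nn_integral_cmult) measurable
    also have "\<dots> \<le> ennreal c * ennreal (C * jbr x powr (2 * (p + q)))"
      by (intro mult_left_mono C jbr_ge_1) auto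
    also have "\<dots> = ennreal (D * C * (jbr x powr (- 2 * (p + q)) * jbr x powr (2 * (p + q))))"
      using c C by (simp add: ennreal_mult[symmetric] c_def mult_ac)
    also have "jbr x powr (- 2 * (p + q)) * jbr x powr (2 * (p + q)) = 1"
      using jbr_pos[of x] by (simp add: powr_add[symmetric])
    finally show ?thesis by simp
  qed
  then show ?thesis using C by (intro exI[of _ "D * C"]) (auto simp: D_def)
qed

text \<open>Moving the weights onto f and g leaves the kernel <x>^(-s0) <x - y>^(-s1) <y>^(-s2); on
  each of the three regions it is \<open>low_kernel\<close> with permuted exponents and
  arguments.\<close>

lemma sobolev_product:
  fixes s0 s1 s2 :: real
  assumes sum: "s0 + s1 + s2 \<ge> DIM('a) / 2" and max: "s0 + s1 + s2 \<ge> max s0 (max s1 s2)"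
    and not_both: "\<not> (s0 + s1 + s2 = DIM('a) / 2 \<and> s0 + s1 + s2 = max s0 (max s1 s2))"
  shows "\<exists>C\<ge>0. \<forall>F G :: 'a::euclidean_space \<Rightarrow> ennreal. F \<in> borel_measurable borel \<longrightarrow> G \<in> borel_measurable borel \<longrightarrow>
     (\<integral>\<^sup>+x. (ennreal (jbr x powr (- s0)) * (\<integral>\<^sup>+y. F (x - y) * G y \<partial>lborel))\<^sup>2 \<partial>lborel)
      \<le> ennreal C * ((\<integral>\<^sup>+x. (ennreal (jbr x powr s1) * F x)\<^sup>2 \<partial>lborel) * (\<integral>\<^sup>+x. (ennreal (jbr x powr s2) * G x)\<^sup>2 \<partial>lborel))"
proof -
  let ?m = "max s0 (max s1 s2)"
  \<comment> \<open>Here c3 is the exponent of the smallest frequency. With S = s0 + s1 + s2, c1 +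
    c2 = S - c3 >= S - \<open>?m\<close> >= 0; and c1 + c2 = 0 together with c3 =
    \<open>DIM('a) / 2\<close> would make both hypotheses equalities.\<close>
  have aux: "c1 + c2 \<ge> 0 \<and> \<not> (c1 + c2 = 0 \<and> c3 = DIM('a) / 2)"
    if "c1 + c2 + c3 = s0 + s1 + s2" "c3 \<le> ?m" for c1 c2 c3
    using that max not_both by linarith
  obtain C1 where C1: "C1 \<ge> 0" "\<And>x::'a. (\<integral>\<^sup>+y. (low_kernel s0 s1 s2 x y)\<^sup>2 \<partial>lborel) \<le> ennreal C1"
    using low_kernel_bound[of s0 s1 s2, where 'a='a] sum aux[of s0 s1 s2] by auto
  obtain C2 where C2: "C2 \<ge> 0" "\<And>x::'a. (\<integral>\<^sup>+y. (low_kernel s0 s2 s1 x y)\<^sup>2 \<partial>lborel) \<le> ennreal C2"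
    using low_kernel_bound[of s0 s2 s1, where 'a='a] sum aux[of s0 s2 s1] by (auto simp: add_ac)
  obtain C3 where C3: "C3 \<ge> 0" "\<And>x::'a. (\<integral>\<^sup>+y. (low_kernel s2 s1 s0 x y)\<^sup>2 \<partial>lborel) \<le> ennreal C3"
    using low_kernel_bound[of s2 s1 s0, where 'a='a] sum aux[of s2 s1 s0] by (auto simp: add_ac)
  have main: "(\<integral>\<^sup>+x. (ennreal (jbr x powr (- s0)) * (\<integral>\<^sup>+y. F (x - y) * G y \<partial>lborel))\<^sup>2 \<partial>lborel)
      \<le> ennreal (9 * (C1 + C2 + C3)) * ((\<integral>\<^sup>+x. (ennreal (jbr x powr s1) * F x)\<^sup>2 \<partial>lborel) * (\<integral>\<^sup>+x. (ennreal (jbr x powr s2) * G x)\<^sup>2 \<partial>lborel))"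
    if [measurable]: "F \<in> borel_measurable borel" "G \<in> borel_measurable borel" for F G :: "'a \<Rightarrow> ennreal"
  proof -
    define f where "f x = ennreal (jbr x powr s1) * F x" for x
    define g where "g x = ennreal (jbr x powr s2) * G x" for x
    have [measurable]: "f \<in> borel_measurable borel" "g \<in> borel_measurable borel"
      unfolding f_def g_def by measurable
    define I where "I k = (\<lambda>x. \<integral>\<^sup>+y. k x y * (f (x - y) * g y) \<partial>lborel)" for k :: "'a \<Rightarrow> 'a \<Rightarrow> ennreal"
    \<comment> \<open>The last argument of \<open>low_kernel\<close> is the smallest frequency: y, x
      - y and x in turn. In \<open>k2\<close> the exponents s1 and s2 trade places because
      \<open>x - (x - y) = y\<close>; in \<open>k3\<close> the roles of x and y are exchanged, so
      that its bound is an integral over x.\<close>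
    define k1 k2 k3 :: "'a \<Rightarrow> 'a \<Rightarrow> ennreal" where "k1 x y = low_kernel s0 s1 s2 x y"
      and "k2 x y = low_kernel s0 s2 s1 x (x - y)" and "k3 x y = low_kernel s2 s1 s0 y x" for x y
    have [measurable]: "(\<lambda>(x, y). k1 x y) \<in> borel_measurable (borel \<Otimes>\<^sub>M borel)"
       "(\<lambda>(x, y). k2 x y) \<in> borel_measurable (borel \<Otimes>\<^sub>M borel)"
       "(\<lambda>(x, y). k3 x y) \<in> borel_measurable (borel \<Otimes>\<^sub>M borel)"
      unfolding k1_def k2_def k3_def case_prod_beta by measurable
    have [measurable]: "I k1 \<in> borel_measurable borel" "I k2 \<in> borel_measurable borel" "I k3 \<in> borel_measurable borel"
      unfolding I_def by measurable
    define N where "N = (\<integral>\<^sup>+x. (f x)\<^sup>2 \<partial>lborel) * (\<integral>\<^sup>+x. (g x)\<^sup>2 \<partial>lborel)"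
    have I1: "(\<integral>\<^sup>+x. (I k1 x)\<^sup>2 \<partial>lborel) \<le> ennreal C1 * N"
      unfolding I_def N_def
      by (rule nn_integral_convolution_kernel_left) (simp_all add: k1_def C1)
    have k2: "(\<integral>\<^sup>+y. (k2 x y)\<^sup>2 \<partial>lborel) \<le> ennreal C2" for x
      using nn_integral_lborel_reflect[of "\<lambda>y. (low_kernel s0 s2 s1 x y)\<^sup>2" x] C2(2)[of x]
      by (simp add: k2_def)
    have I2: "(\<integral>\<^sup>+x. (I k2 x)\<^sup>2 \<partial>lborel) \<le> ennreal C2 * N"
      unfolding I_def N_def
      by (rule nn_integral_convolution_kernel_left) (simp_all add: k2)
    have I3: "(\<integral>\<^sup>+x. (I k3 x)\<^sup>2 \<partial>lborel) \<le> ennreal C3 * N"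
      unfolding I_def N_def
      by (rule nn_integral_convolution_kernel_right) (simp_all add: k3_def C3)
    have pt: "ennreal (jbr x powr (- s0)) * (F (x - y) * G y) \<le> k1 x y * (f (x - y) * g y) + k2 x y * (f (x - y) * g y) + k3 x y * (f (x - y) * g y)"
      for x y
    proof -
      have jj: "jbr z powr (- s) * jbr z powr s = 1" for s and z :: 'a
        using jbr_pos[of z] by (simp add: powr_add[symmetric])
      define w where "w = ennreal (jbr x powr (- s0) * jbr (x - y) powr (- s1) * jbr y powr (- s2))"
      have "F (x - y) = ennreal (jbr (x - y) powr (- s1)) * f (x - y)" "G y = ennreal (jbr y powr (- s2)) * g y"
        by (simp_all add: f_def g_def mult.assoc[symmetric] ennreal_mult[symmetric] jj)
      then have eq: "ennreal (jbr x powr (- s0)) * (F (x - y) * G y) = w * (f (x - y) * g y)"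
        by (simp add: w_def ennreal_mult mult_ac)
      have "w \<le> k1 x y + k2 x y + k3 x y"
      proof -
        \<comment> \<open>The regions overlap on ties, which is harmless for an upper bound by the
          sum.\<close>
        consider "jbr y \<le> jbr x" "jbr y \<le> jbr (x - y)" | "jbr (x - y) \<le> jbr x" "jbr (x - y) \<le> jbr y"
          | "jbr x \<le> jbr y" "jbr x \<le> jbr (y - x)"
          using jbr_minus_commute[of x y] by linarith
        then show ?thesis
        proof cases
          case 1
          then have "w = k1 x y" by (simp add: w_def k1_def low_kernel_def)
          then show ?thesis by (simp add: add.assoc)
        next
          case 2
          then have "w = k2 x y" by (simp add: w_def k2_def low_kernel_def mult_ac)
          then show ?thesis by (simp add: add_increasing add_increasing2)
        next
          case 3
          then have "w = k3 x y" by (simp add: w_def k3_def low_kernel_def jbr_minus_commute[of x y] mult_ac)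
          then show ?thesis by (simp add: add_increasing)
        qed
      qed
      then show ?thesis
        unfolding eq by (simp add: distrib_right[symmetric] mult_right_mono)
    qed
    have "(\<integral>\<^sup>+x. (ennreal (jbr x powr (- s0)) * (\<integral>\<^sup>+y. F (x - y) * G y \<partial>lborel))\<^sup>2 \<partial>lborel)
       \<le> (\<integral>\<^sup>+x. 9 * ((I k1 x)\<^sup>2 + (I k2 x)\<^sup>2 + (I k3 x)\<^sup>2) \<partial>lborel)"
    proof (rule nn_integral_mono)
      fix x
      have "ennreal (jbr x powr (- s0)) * (\<integral>\<^sup>+y. F (x - y) * G y \<partial>lborel) = (\<integral>\<^sup>+y. ennreal (jbr x powr (- s0)) * (F (x - y) * G y) \<partial>lborel)"
        by (rule nn_integral_cmult[symmetric]) measurable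
      also have "\<dots> \<le> (\<integral>\<^sup>+y. k1 x y * (f (x - y) * g y) + k2 x y * (f (x - y) * g y) + k3 x y * (f (x - y) * g y) \<partial>lborel)"
        by (intro nn_integral_mono pt)
      also have "\<dots> = I k1 x + I k2 x + I k3 x"
        by (simp add: I_def nn_integral_add)
      finally have "(ennreal (jbr x powr (- s0)) * (\<integral>\<^sup>+y. F (x - y) * G y \<partial>lborel))\<^sup>2 \<le> (I k1 x + I k2 x + I k3 x)\<^sup>2"
        by (rule power_mono) simp
      then show "(ennreal (jbr x powr (- s0)) * (\<integral>\<^sup>+y. F (x - y) * G y \<partial>lborel))\<^sup>2 \<le> 9 * ((I k1 x)\<^sup>2 + (I k2 x)\<^sup>2 + (I k3 x)\<^sup>2)"
        using ennreal_power2_sum3 order_trans by blast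
    qed
    also have "\<dots> = 9 * ((\<integral>\<^sup>+x. (I k1 x)\<^sup>2 \<partial>lborel) + (\<integral>\<^sup>+x. (I k2 x)\<^sup>2 \<partial>lborel) + (\<integral>\<^sup>+x. (I k3 x)\<^sup>2 \<partial>lborel))"
      by (simp add: nn_integral_cmult nn_integral_add)
    also have "\<dots> \<le> 9 * (ennreal C1 * N + ennreal C2 * N + ennreal C3 * N)"
      by (intro mult_left_mono add_mono I1 I2 I3) simp
    also have "\<dots> = 9 * (ennreal (C1 + C2 + C3)) * N"
      using C1 C2 C3 by (simp add: distrib_right mult.assoc)
    also have "9 * (ennreal (C1 + C2 + C3)) = ennreal (9 * (C1 + C2 + C3))"
      using C1 C2 C3 by (subst ennreal_mult) auto
    finally show ?thesis
      unfolding N_def f_def g_def .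
  qed
  show ?thesis
    using C1 C2 C3 main by (intro exI[of _ "9 * (C1 + C2 + C3)"]) auto
qed

section \<open>Reduction of the wave-Sobolev estimate\<close>

lemma borel_measurable_fst_comp [measurable]:
  fixes f :: "'c \<Rightarrow> 'a::second_countable_topology \<times> 'b::second_countable_topology"
  assumes "f \<in> borel_measurable M"
  shows "(\<lambda>x. fst (f x)) \<in> borel_measurable M"
  using measurable_compose[OF assms, of fst borel] by (simp add: borel_prod[symmetric])

lemma borel_measurable_snd_comp [measurable]:
  fixes f :: "'c \<Rightarrow> 'a::second_countable_topology \<times> 'b::second_countable_topology"
  assumes "f \<in> borel_measurable M"
  shows "(\<lambda>x. snd (f x)) \<in> borel_measurable M"
  using measurable_compose[OF assms, of snd borel] by (simp add: borel_prod[symmetric])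

text \<open>Total on \<open>ennreal\<close>, so that the L^2 norm in time of any measurable
  function, infinite values included, can serve as the bound \<open>A\<close> in
  \<open>nn_integral_Minkowski\<close>.\<close>

definition ennsqrt :: "ennreal \<Rightarrow> ennreal" where
  "ennsqrt x = (if x = top then top else ennreal (sqrt (enn2real x)))"

lemma ennsqrt_power2: "(ennsqrt x)\<^sup>2 = x"
  by (cases x) (auto simp: ennsqrt_def ennreal_power)

lemma ennsqrt_measurable [measurable]: "ennsqrt \<in> borel_measurable borel"
  unfolding ennsqrt_def by measurable

text \<open>Depending on the sign of t, |t| - \<rho> equals t - \<rho> or - \<rho> - t. The squared
  weight is thus at most a sum of two functions whose integrals do not depend on \<rho>, and these
  are finite because 2 b > 1.\<close>

lemma nn_integral_cone_weight:
  assumes "b > 1/2"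
  shows "\<exists>C\<ge>0. \<forall>\<rho>::real. (\<integral>\<^sup>+t. (ennreal (jbr (\<bar>t\<bar> - \<rho>) powr (- b)))\<^sup>2 \<partial>lborel) \<le> ennreal C"
proof -
  obtain J where J: "J \<ge> 0" "(\<integral>\<^sup>+t. ennreal (jbr (t::real) powr (- (2 * b))) \<partial>lborel) \<le> ennreal J"
    using nn_integral_jbr_finite[of "2 * b"] assms by auto
  have "(\<integral>\<^sup>+t. (ennreal (jbr (\<bar>t\<bar> - \<rho>) powr (- b)))\<^sup>2 \<partial>lborel) \<le> ennreal (2 * J)" for \<rho> :: real
  proof -
    define f where "f t = ennreal (jbr (t::real) powr (- (2 * b)))" for t
    have [measurable]: "f \<in> borel_measurable borel"
      unfolding f_def by measurable
    have pt: "(ennreal (jbr (\<bar>t\<bar> - \<rho>) powr (- b)))\<^sup>2 \<le> f (t - \<rho>) + f (- \<rho> - t)" for t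
    proof -
      have "(ennreal (jbr (\<bar>t\<bar> - \<rho>) powr (- b)))\<^sup>2 = f (\<bar>t\<bar> - \<rho>)"
        using jbr_pos[of "\<bar>t\<bar> - \<rho>"]
        by (simp add: f_def ennreal_power powr_realpow[symmetric] powr_powr mult.commute)
      also have "\<dots> \<le> f (t - \<rho>) + f (- \<rho> - t)"
      proof (cases "t \<ge> 0")
        case False
        then have "\<bar>t\<bar> - \<rho> = - \<rho> - t" by simp
        then show ?thesis by (simp only: add_increasing order_refl zero_le)
      qed simp
      finally show ?thesis .
    qed
    have "(\<integral>\<^sup>+t. (ennreal (jbr (\<bar>t\<bar> - \<rho>) powr (- b)))\<^sup>2 \<partial>lborel) \<le> (\<integral>\<^sup>+t. f (t - \<rho>) + f (- \<rho> - t) \<partial>lborel)"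
      by (intro nn_integral_mono pt)
    also have "\<dots> = (\<integral>\<^sup>+t. f (t - \<rho>) \<partial>lborel) + (\<integral>\<^sup>+t. f (- \<rho> - t) \<partial>lborel)"
      by (rule nn_integral_add) measurable
    also have "\<dots> = (\<integral>\<^sup>+t. f t \<partial>lborel) + (\<integral>\<^sup>+t. f t \<partial>lborel)"
      by (simp only: nn_integral_lborel_shift nn_integral_lborel_reflect \<open>f \<in> borel_measurable borel\<close>)
    also have "\<dots> \<le> ennreal J + ennreal J"
      using J by (intro add_mono) (simp_all add: f_def)
    also have "\<dots> = ennreal (2 * J)"
      using J by (subst ennreal_plus[symmetric]) auto
    finally show ?thesis .
  qed
  then show ?thesis using J by (intro exI[of _ "2 * J"]) simp
qed

text \<open>No weight in the time frequency falls on U or on the output, so their weights pass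
  through the time integral. What remains is \<open>sobolev_product\<close> for \<open>a\<close>,
  the L^2 norm of U in time, and \<open>\<beta>\<close>, the integral of V in time.\<close>

lemma wave_sobolev_convolution:
  fixes s0 s1 s2 b :: real
  assumes "b > 1/2"
    and "s0 + s1 + s2 \<ge> DIM('a) / 2" and "s0 + s1 + s2 \<ge> max s0 (max s1 s2)"
    and "\<not> (s0 + s1 + s2 = DIM('a) / 2 \<and> s0 + s1 + s2 = max s0 (max s1 s2))"
  shows "\<exists>C\<ge>0. \<forall>U V :: real \<times> 'a::euclidean_space \<Rightarrow> ennreal.
     U \<in> borel_measurable borel \<longrightarrow> V \<in> borel_measurable borel \<longrightarrow>
     (\<integral>\<^sup>+p. (ennreal (jbr (snd p) powr (- s0)) * (\<integral>\<^sup>+q. U (p - q) * V q \<partial>lborel))\<^sup>2 \<partial>lborel)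
      \<le> ennreal C * ((\<integral>\<^sup>+p. (ennreal (jbr (snd p) powr s1) * U p)\<^sup>2 \<partial>lborel) *
          (\<integral>\<^sup>+p. (ennreal (jbr (snd p) powr s2 * jbr (\<bar>fst p\<bar> - norm (snd p)) powr b) * V p)\<^sup>2 \<partial>lborel))"
proof -
  obtain J where J: "J \<ge> 0" "\<And>\<rho>::real. (\<integral>\<^sup>+t. (ennreal (jbr (\<bar>t\<bar> - \<rho>) powr (- b)))\<^sup>2 \<partial>lborel) \<le> ennreal J"
    using nn_integral_cone_weight[OF assms(1)] by blast
  obtain K where K: "K \<ge> 0" "\<And>F G :: 'a \<Rightarrow> ennreal. F \<in> borel_measurable borel \<Longrightarrow> G \<in> borel_measurable borel \<Longrightarrow>
     (\<integral>\<^sup>+x. (ennreal (jbr x powr (- s0)) * (\<integral>\<^sup>+y. F (x - y) * G y \<partial>lborel))\<^sup>2 \<partial>lborel)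
      \<le> ennreal K * ((\<integral>\<^sup>+x. (ennreal (jbr x powr s1) * F x)\<^sup>2 \<partial>lborel) * (\<integral>\<^sup>+x. (ennreal (jbr x powr s2) * G x)\<^sup>2 \<partial>lborel))"
    using sobolev_product[OF assms(2-4)] by blast
  have main: "(\<integral>\<^sup>+p. (ennreal (jbr (snd p) powr (- s0)) * (\<integral>\<^sup>+q. U (p - q) * V q \<partial>lborel))\<^sup>2 \<partial>lborel)
      \<le> ennreal (K * J) * ((\<integral>\<^sup>+p. (ennreal (jbr (snd p) powr s1) * U p)\<^sup>2 \<partial>lborel) *
          (\<integral>\<^sup>+p. (ennreal (jbr (snd p) powr s2 * jbr (\<bar>fst p\<bar> - norm (snd p)) powr b) * V p)\<^sup>2 \<partial>lborel))"
    if [measurable]: "U \<in> borel_measurable borel" "V \<in> borel_measurable borel" for U V :: "real \<times> 'a \<Rightarrow> ennreal"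
  proof -
    have split: "(\<integral>\<^sup>+p. f p \<partial>lborel) = (\<integral>\<^sup>+x. \<integral>\<^sup>+t. f (t, x) \<partial>lborel \<partial>lborel)"
      if "f \<in> borel_measurable borel" for f :: "real \<times> 'a \<Rightarrow> ennreal"
      using that lborel_pair.nn_integral_snd[of f] by (simp add: lborel_prod)
    define a where "a x = ennsqrt (\<integral>\<^sup>+t. (U (t, x))\<^sup>2 \<partial>lborel)" for x
    define \<beta> where "\<beta> x = (\<integral>\<^sup>+t. V (t, x) \<partial>lborel)" for x
    have [measurable]: "a \<in> borel_measurable borel" "\<beta> \<in> borel_measurable borel"
      unfolding a_def \<beta>_def by measurable
    have time: "(\<integral>\<^sup>+t. (\<integral>\<^sup>+q. U ((t, x) - q) * V q \<partial>lborel)\<^sup>2 \<partial>lborel) \<le> (\<integral>\<^sup>+y. a (x - y) * \<beta> y \<partial>lborel)\<^sup>2" for x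
    proof -
      \<comment> \<open>Minkowski with the full frequency q as parameter: for fixed q a shift in t
        leaves the L^2 norm of U unchanged, so Young's inequality for L^2 and L^1 comes out without
        a separate proof.\<close>
      have "(\<integral>\<^sup>+t. (\<integral>\<^sup>+q. U ((t, x) - q) * V q \<partial>lborel)\<^sup>2 \<partial>lborel) \<le> (\<integral>\<^sup>+q. a (x - snd q) * V q \<partial>lborel)\<^sup>2"
      proof (rule nn_integral_Minkowski)
        fix q :: "real \<times> 'a"
        have "(\<integral>\<^sup>+t. (U (t - fst q, x - snd q))\<^sup>2 \<partial>lborel) = (a (x - snd q))\<^sup>2"
          using nn_integral_lborel_shift[of "\<lambda>t. (U (t, x - snd q))\<^sup>2" "fst q"]
          by (simp add: a_def ennsqrt_power2)
        then show "(\<integral>\<^sup>+t. (U ((t, x) - q) * V q)\<^sup>2 \<partial>lborel) \<le> (a (x - snd q) * V q)\<^sup>2"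
          by (simp add: minus_prod_def power_mult_distrib nn_integral_multc)
      qed measurable
      also have "(\<integral>\<^sup>+q. a (x - snd q) * V q \<partial>lborel) = (\<integral>\<^sup>+y. a (x - y) * \<beta> y \<partial>lborel)"
        by (subst split) (simp_all add: nn_integral_cmult \<beta>_def)
      finally show ?thesis .
    qed
    have a_eq: "(\<integral>\<^sup>+x. (ennreal (jbr x powr s1) * a x)\<^sup>2 \<partial>lborel) = (\<integral>\<^sup>+p. (ennreal (jbr (snd p) powr s1) * U p)\<^sup>2 \<partial>lborel)"
      by (subst split) (simp_all add: nn_integral_cmult power_mult_distrib a_def ennsqrt_power2)
    have \<beta>_bound: "(\<integral>\<^sup>+x. (ennreal (jbr x powr s2) * \<beta> x)\<^sup>2 \<partial>lborel) \<le>
       ennreal J * (\<integral>\<^sup>+p. (ennreal (jbr (snd p) powr s2 * jbr (\<bar>fst p\<bar> - norm (snd p)) powr b) * V p)\<^sup>2 \<partial>lborel)"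
    proof -
      have cs: "(\<beta> x)\<^sup>2 \<le> ennreal J * (\<integral>\<^sup>+t. (ennreal (jbr (\<bar>t\<bar> - norm x) powr b) * V (t, x))\<^sup>2 \<partial>lborel)" for x
      proof -
        have "ennreal (jbr (\<bar>t\<bar> - norm x) powr - b) * (ennreal (jbr (\<bar>t\<bar> - norm x) powr b) * V (t, x)) = V (t, x)" for t
          using jbr_pos[of "\<bar>t\<bar> - norm x"]
          by (simp add: mult.assoc[symmetric] ennreal_mult[symmetric] powr_add[symmetric])
        then have "(\<beta> x)\<^sup>2 = (\<integral>\<^sup>+t. ennreal (jbr (\<bar>t\<bar> - norm x) powr - b) * (ennreal (jbr (\<bar>t\<bar> - norm x) powr b) * V (t, x)) \<partial>lborel)\<^sup>2"
          by (simp add: \<beta>_def)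
        also have "\<dots> \<le> (\<integral>\<^sup>+t. (ennreal (jbr (\<bar>t\<bar> - norm x) powr - b))\<^sup>2 \<partial>lborel) * (\<integral>\<^sup>+t. (ennreal (jbr (\<bar>t\<bar> - norm x) powr b) * V (t, x))\<^sup>2 \<partial>lborel)"
          by (rule Cauchy_Schwarz_nn_integral) measurable
        also have "\<dots> \<le> ennreal J * (\<integral>\<^sup>+t. (ennreal (jbr (\<bar>t\<bar> - norm x) powr b) * V (t, x))\<^sup>2 \<partial>lborel)"
          by (intro mult_right_mono J) simp
        finally show ?thesis .
      qed
      have "(\<integral>\<^sup>+x. (ennreal (jbr x powr s2) * \<beta> x)\<^sup>2 \<partial>lborel) \<le>
        (\<integral>\<^sup>+x. (ennreal (jbr x powr s2))\<^sup>2 * (ennreal J * (\<integral>\<^sup>+t. (ennreal (jbr (\<bar>t\<bar> - norm x) powr b) * V (t, x))\<^sup>2 \<partial>lborel)) \<partial>lborel)"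
        unfolding power_mult_distrib[of "ennreal (jbr x powr s2)" "\<beta> x" for x]
        by (intro nn_integral_mono mult_left_mono cs) simp
      also have "\<dots> = ennreal J * (\<integral>\<^sup>+x. \<integral>\<^sup>+t. (ennreal (jbr x powr s2 * jbr (\<bar>t\<bar> - norm x) powr b) * V (t, x))\<^sup>2 \<partial>lborel \<partial>lborel)"
        by (simp add: nn_integral_cmult[symmetric] power_mult_distrib ennreal_mult mult_ac)
      also have "\<dots> = ennreal J * (\<integral>\<^sup>+p. (ennreal (jbr (snd p) powr s2 * jbr (\<bar>fst p\<bar> - norm (snd p)) powr b) * V p)\<^sup>2 \<partial>lborel)"
        by (subst split) simp_all
      finally show ?thesis .
    qed
    have "(\<integral>\<^sup>+p. (ennreal (jbr (snd p) powr (- s0)) * (\<integral>\<^sup>+q. U (p - q) * V q \<partial>lborel))\<^sup>2 \<partial>lborel)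
       = (\<integral>\<^sup>+x. (ennreal (jbr x powr (- s0)))\<^sup>2 * (\<integral>\<^sup>+t. (\<integral>\<^sup>+q. U ((t, x) - q) * V q \<partial>lborel)\<^sup>2 \<partial>lborel) \<partial>lborel)"
      by (subst split) (simp_all add: nn_integral_cmult power_mult_distrib)
    also have "\<dots> \<le> (\<integral>\<^sup>+x. (ennreal (jbr x powr (- s0)) * (\<integral>\<^sup>+y. a (x - y) * \<beta> y \<partial>lborel))\<^sup>2 \<partial>lborel)"
      unfolding power_mult_distrib by (intro nn_integral_mono mult_left_mono time) auto
    also have "\<dots> \<le> ennreal K * ((\<integral>\<^sup>+x. (ennreal (jbr x powr s1) * a x)\<^sup>2 \<partial>lborel) * (\<integral>\<^sup>+x. (ennreal (jbr x powr s2) * \<beta> x)\<^sup>2 \<partial>lborel))"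
      by (rule K) measurable
    also have "\<dots> \<le> ennreal K * ((\<integral>\<^sup>+p. (ennreal (jbr (snd p) powr s1) * U p)\<^sup>2 \<partial>lborel) * (ennreal J *
       (\<integral>\<^sup>+p. (ennreal (jbr (snd p) powr s2 * jbr (\<bar>fst p\<bar> - norm (snd p)) powr b) * V p)\<^sup>2 \<partial>lborel)))"
      unfolding a_eq by (intro mult_left_mono \<beta>_bound) auto
    finally show ?thesis
      using J(1) K(1) by (simp add: ennreal_mult mult_ac)
  qed
  show ?thesis
    using J K main by (intro exI[of _ "K * J"]) auto
qed

section \<open>Fourier transform and inversion\<close>

lemma integrable_lborel_jbr_bound:
  fixes f :: "'a::euclidean_space \<Rightarrow> 'b::{banach, second_countable_topology}" and q :: real
  assumes [measurable]: "f \<in> borel_measurable borel" and "q > DIM('a)"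
    and le: "\<And>z. norm (f z) \<le> C * jbr z powr (- q)"
  shows "integrable lborel f"
proof (rule integrableI_bounded)
  obtain J where J: "(\<integral>\<^sup>+y. ennreal (jbr (y::'a) powr (- q)) \<partial>lborel) \<le> ennreal J"
    using nn_integral_jbr_finite_euclidean[OF assms(2)] by blast
  have "0 \<le> C"
    using order_trans[OF norm_ge_zero le[of 0]] by (simp add: jbr_def)
  note C = this
  have "(\<integral>\<^sup>+z. ennreal (norm (f z)) \<partial>lborel) \<le> (\<integral>\<^sup>+z. ennreal C * ennreal (jbr (z::'a) powr (- q)) \<partial>lborel)"
    by (intro nn_integral_mono) (simp add: ennreal_mult[symmetric] ennreal_leI le C)
  also have "\<dots> = ennreal C * (\<integral>\<^sup>+z. ennreal (jbr (z::'a) powr (- q)) \<partial>lborel)"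
    by (rule nn_integral_cmult) measurable
  also have "\<dots> \<le> ennreal C * ennreal J"
    by (intro mult_left_mono J) simp
  also have "\<dots> < \<infinity>"
    by (simp add: ennreal_mult_less_top)
  finally show "(\<integral>\<^sup>+z. ennreal (norm (f z)) \<partial>lborel) < \<infinity>" .
qed simp

lemma integrable_lborel_affine:
  fixes f :: "'a::euclidean_space \<Rightarrow> 'b::{banach, second_countable_topology}"
  assumes "integrable lborel f" and c: "c \<noteq> 0"
  shows "integrable lborel (\<lambda>x. f (t + c *\<^sub>R x))"
proof -
  have [measurable]: "f \<in> borel_measurable borel"
    using borel_measurable_integrable[OF assms(1)] by simp
  have "integrable (density (distr lborel borel (\<lambda>x. t + c *\<^sub>R x)) (\<lambda>_. ennreal (\<bar>c\<bar> ^ DIM('a)))) f"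
    using assms(1) lborel_affine[OF c, of t] by simp
  then have "integrable lborel (\<lambda>x. \<bar>c\<bar> ^ DIM('a) *\<^sub>R f (t + c *\<^sub>R x))"
    by (simp add: integrable_density integrable_distr_eq)
  then have "integrable lborel (\<lambda>x. inverse (\<bar>c\<bar> ^ DIM('a)) *\<^sub>R (\<bar>c\<bar> ^ DIM('a) *\<^sub>R f (t + c *\<^sub>R x)))"
    by (rule integrable_scaleR_right)
  then show ?thesis using c by simp
qed

lemma integral_lborel_affine:
  fixes f :: "'a::euclidean_space \<Rightarrow> 'b::{banach, second_countable_topology}"
  assumes [measurable]: "f \<in> borel_measurable borel" and c: "c \<noteq> 0"
  shows "(\<integral>x. f x \<partial>lborel) = \<bar>c\<bar> ^ DIM('a) *\<^sub>R (\<integral>x. f (t + c *\<^sub>R x) \<partial>lborel)"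
proof -
  have "(\<integral>x. f x \<partial>lborel) = (\<integral>x. f x \<partial>(density (distr lborel borel (\<lambda>x. t + c *\<^sub>R x)) (\<lambda>_. ennreal (\<bar>c\<bar> ^ DIM('a)))))"
    using lborel_affine[OF c, of t] by simp
  also have "\<dots> = (\<integral>x. \<bar>c\<bar> ^ DIM('a) *\<^sub>R f (t + c *\<^sub>R x) \<partial>lborel)"
    by (simp add: integral_density integral_distr)
  finally show ?thesis by simp
qed

text \<open>Supplies the integrability for Fubini in \<open>gaussian_average\<close> and
  \<open>fourier_mult\<close>, where c is an oscillating exponential.\<close>

lemma integrable_tensor_bound:
  fixes c :: "'a::euclidean_space \<Rightarrow> 'b::euclidean_space \<Rightarrow> complex" and g h :: "_ \<Rightarrow> complex"
  assumes "integrable lborel g" "integrable lborel h"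
    and [measurable]: "(\<lambda>(x, y). c x y) \<in> borel_measurable (borel \<Otimes>\<^sub>M borel)" and c: "\<And>x y. norm (c x y) \<le> 1"
  shows "integrable (lborel \<Otimes>\<^sub>M lborel) (\<lambda>(x, y). c x y * (g x * h y))"
proof (rule integrableI_bounded)
  have [measurable]: "g \<in> borel_measurable borel" "h \<in> borel_measurable borel"
    using borel_measurable_integrable[OF assms(1)] borel_measurable_integrable[OF assms(2)] by simp_all
  show "(\<lambda>(x, y). c x y * (g x * h y)) \<in> borel_measurable (lborel \<Otimes>\<^sub>M lborel)"
    by measurable
  have "(\<integral>\<^sup>+p. ennreal (norm (case p of (x, y) \<Rightarrow> c x y * (g x * h y))) \<partial>(lborel \<Otimes>\<^sub>M lborel))
     \<le> (\<integral>\<^sup>+p. ennreal (norm (g (fst p))) * ennreal (norm (h (snd p))) \<partial>(lborel \<Otimes>\<^sub>M lborel))"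
  proof (intro nn_integral_mono)
    fix p :: "'a \<times> 'b"
    have "norm (c (fst p) (snd p)) * (norm (g (fst p)) * norm (h (snd p))) \<le> norm (g (fst p)) * norm (h (snd p))"
      using c by (intro mult_left_le_one_le) auto
    then show "ennreal (norm (case p of (x, y) \<Rightarrow> c x y * (g x * h y))) \<le> ennreal (norm (g (fst p))) * ennreal (norm (h (snd p)))"
      by (simp add: case_prod_beta norm_mult ennreal_mult[symmetric] ennreal_leI)
  qed
  also have "\<dots> = (\<integral>\<^sup>+x. ennreal (norm (g x)) \<partial>lborel) * (\<integral>\<^sup>+y. ennreal (norm (h y)) \<partial>lborel)"
    by (subst lborel.nn_integral_fst[symmetric]) (simp_all add: nn_integral_cmult nn_integral_multc)
  also have "\<dots> < \<infinity>"
    using assms(1,2) by (simp add: integrable_iff_bounded ennreal_mult_less_top)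
  finally show "(\<integral>\<^sup>+p. ennreal (norm (case p of (x, y) \<Rightarrow> c x y * (g x * h y))) \<partial>(lborel \<Otimes>\<^sub>M lborel)) < \<infinity>" .
qed

lemma cis_measurable [measurable]: "cis \<in> borel_measurable borel"
  by (intro borel_measurable_continuous_onI continuous_intros)

text \<open>Stated on an arbitrary Euclidean space, as inversion and decay do not distinguish time
  from space; \<open>ft_eq_fourier\<close> identifies it with \<open>ft\<close>.\<close>

definition fourier :: "('a::euclidean_space \<Rightarrow> complex) \<Rightarrow> 'a \<Rightarrow> complex" where
  "fourier f \<zeta> = (\<integral>z. cis (- (z \<bullet> \<zeta>)) * f z \<partial>lborel)"

lemma fourier_measurable [measurable]:
  assumes [measurable]: "f \<in> borel_measurable borel"
  shows "fourier f \<in> borel_measurable borel"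
  unfolding fourier_def by measurable

lemma integrable_cis_mult:
  fixes f :: "'a::euclidean_space \<Rightarrow> complex"
  assumes "integrable lborel f" and [measurable]: "\<theta> \<in> borel_measurable borel"
  shows "integrable lborel (\<lambda>z. cis (\<theta> z) * f z)"
proof -
  have [measurable]: "f \<in> borel_measurable borel"
    using borel_measurable_integrable[OF assms(1)] by simp
  show ?thesis
    by (rule Bochner_Integration.integrable_bound[OF assms(1)]) (simp_all add: norm_mult)
qed

lemma norm_fourier_le:
  assumes "integrable lborel f"
  shows "norm (fourier f \<zeta>) \<le> (\<integral>z. norm (f z) \<partial>lborel)"
  unfolding fourier_def
  using integral_norm_bound[of lborel "\<lambda>z. cis (- (z \<bullet> \<zeta>)) * f z"] by (simp add: norm_mult)

section \<open>The Gaussian and its Fourier transform\<close>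

definition gauss :: "'a::euclidean_space \<Rightarrow> real" where
  "gauss x = exp (- ((norm x)\<^sup>2 / 2))"

lemma gauss_continuous: "continuous_on S gauss"
  unfolding gauss_def by (intro continuous_intros) auto

lemma gauss_measurable [measurable]: "gauss \<in> borel_measurable borel"
  by (intro borel_measurable_continuous_onI gauss_continuous)

lemma gauss_prod: "gauss x = (\<Prod>b\<in>Basis. exp (- ((x \<bullet> b)\<^sup>2 / 2)))"
proof -
  have "(norm x)\<^sup>2 = (\<Sum>b\<in>Basis. (x \<bullet> b)\<^sup>2)"
    by (subst power2_norm_eq_inner, subst euclidean_inner) (simp add: power2_eq_square)
  then show ?thesis
    by (simp add: gauss_def exp_sum[symmetric] sum_negf sum_divide_distrib)
qed

lemma gauss_le_1: "gauss x \<le> 1"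
  by (simp add: gauss_def)

lemma gauss_pos: "gauss x > 0"
  by (simp add: gauss_def)

text \<open>Read off from the characteristic function of the standard normal distribution; the
  factor sqrt (2 pi) undoes the normalisation of its density.\<close>

lemma gauss_1D:
  "integrable lborel (\<lambda>x::real. exp (- (x\<^sup>2 / 2)))"
  "(\<integral>x. cis (x * t) * complex_of_real (exp (- (x\<^sup>2 / 2))) \<partial>lborel) = complex_of_real (sqrt (2 * pi) * exp (- (t\<^sup>2 / 2)))"
proof -
  have eq: "exp (- (x\<^sup>2 / 2)) = sqrt (2 * pi) * std_normal_density x" for x :: real
    by (simp add: std_normal_density_def)
  show "integrable lborel (\<lambda>x::real. exp (- (x\<^sup>2 / 2)))"
    unfolding eq by (intro integrable_mult_right) simp
  have "complex_of_real (exp (- (t\<^sup>2 / 2))) = char std_normal_distribution t"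
    by (simp add: char_std_normal_distribution)
  also have "\<dots> = (\<integral>x. std_normal_density x *\<^sub>R exp (\<i> * complex_of_real (t * x)) \<partial>lborel)"
    unfolding char_def by (subst integral_density) auto
  finally have "(\<integral>x. std_normal_density x *\<^sub>R exp (\<i> * complex_of_real (t * x)) \<partial>lborel) = complex_of_real (exp (- (t\<^sup>2 / 2)))" ..
  moreover have "(\<integral>x. cis (x * t) * complex_of_real (exp (- (x\<^sup>2 / 2))) \<partial>lborel) =
      (\<integral>x. complex_of_real (sqrt (2 * pi)) * (std_normal_density x *\<^sub>R exp (\<i> * complex_of_real (t * x))) \<partial>lborel)"
    unfolding eq by (intro Bochner_Integration.integral_cong refl) (simp add: cis_conv_exp scaleR_conv_of_real mult_ac)
  ultimately show "(\<integral>x. cis (x * t) * complex_of_real (exp (- (x\<^sup>2 / 2))) \<partial>lborel) = complex_of_real (sqrt (2 * pi) * exp (- (t\<^sup>2 / 2)))"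
    by (simp only: integral_mult_right_zero of_real_mult)
qed

lemma integral_lborel_prod:
  fixes f :: "'a::euclidean_space \<Rightarrow> real \<Rightarrow> complex"
  assumes f: "\<And>b. b \<in> Basis \<Longrightarrow> integrable lborel (f b)"
  shows "(\<integral>x. (\<Prod>b\<in>Basis. f b (x \<bullet> b)) \<partial>lborel) = (\<Prod>b\<in>Basis. (\<integral>t. f b t \<partial>lborel))"
    and "integrable lborel (\<lambda>x. \<Prod>b\<in>Basis. f b (x \<bullet> b))"
proof -
  interpret product_sigma_finite "\<lambda>b::'a. lborel :: real measure"
    by unfold_locales
  have [measurable]: "f b \<in> borel_measurable borel" if "b \<in> Basis" for b
    using borel_measurable_integrable[OF f[OF that]] by simp
  have comp: "(\<Prod>b\<in>Basis. f b ((\<Sum>i\<in>Basis. x i *\<^sub>R i) \<bullet> b)) = (\<Prod>b\<in>Basis. f b (x b))" for x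
    by (intro prod.cong) auto
  show "(\<integral>x. (\<Prod>b\<in>Basis. f b (x \<bullet> b)) \<partial>lborel) = (\<Prod>b\<in>Basis. (\<integral>t. f b t \<partial>lborel))"
    by (subst lborel_eq) (simp add: integral_distr comp product_integral_prod f)
  show "integrable lborel (\<lambda>x. \<Prod>b\<in>Basis. f b (x \<bullet> b))"
    by (subst lborel_eq) (simp add: integrable_distr_eq comp product_integrable_prod f)
qed

lemma fourier_gauss:
  fixes \<zeta> :: "'a::euclidean_space"
  shows "(\<integral>x. cis (x \<bullet> \<zeta>) * complex_of_real (gauss x) \<partial>lborel) = complex_of_real (sqrt (2 * pi) ^ DIM('a) * gauss \<zeta>)"
    and "integrable lborel (\<lambda>x::'a. complex_of_real (gauss x))"
proof -
  have cis_sum: "cis (\<Sum>b\<in>(Basis::'a set). h b) = (\<Prod>b\<in>Basis. cis (h b))" for h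
    by (simp add: cis_conv_exp sum_distrib_left exp_sum)
  define f where "f b = (\<lambda>t. cis (t * (\<zeta> \<bullet> b)) * complex_of_real (exp (- (t\<^sup>2 / 2))))" for b
  have int: "integrable lborel (f b)" for b
    unfolding f_def by (intro integrable_cis_mult integrable_of_real gauss_1D) auto
  have eq: "cis (x \<bullet> \<zeta>) * complex_of_real (gauss x) = (\<Prod>b\<in>Basis. f b (x \<bullet> b))" for x
    unfolding f_def prod.distrib gauss_prod of_real_prod cis_sum[symmetric] euclidean_inner[of x \<zeta>] ..
  show "(\<integral>x. cis (x \<bullet> \<zeta>) * complex_of_real (gauss x) \<partial>lborel) = complex_of_real (sqrt (2 * pi) ^ DIM('a) * gauss \<zeta>)"
    unfolding eq by (subst integral_lborel_prod[OF int]) (simp add: f_def gauss_1D gauss_prod prod.distrib)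
  \<comment> \<open>Integrability is known for the product of the \<open>f b\<close>, that is, for
    the Gaussian times a phase; the opposite phase recovers the Gaussian.\<close>
  have "integrable lborel (\<lambda>x. cis (- (x \<bullet> \<zeta>)) * (cis (x \<bullet> \<zeta>) * complex_of_real (gauss x)))"
    unfolding eq by (rule integrable_cis_mult[OF integral_lborel_prod(2)[OF int]]) measurable
  then show "integrable lborel (\<lambda>x::'a. complex_of_real (gauss x))"
    by (simp add: mult.assoc[symmetric] cis_mult)
qed

text \<open>The multiplication formula for v and a Gaussian: the Gaussian on the left is written as
  a transform, Fubini moves the transform to v, and the scaling by \<epsilon> passes to the
  frequency side. The left side is a smoothed value of v at z, the right side a damped inversion
  integral.\<close>

lemma gaussian_average:
  fixes v :: "'a::euclidean_space \<Rightarrow> complex"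
  assumes v: "integrable lborel v" and \<epsilon>: "\<epsilon> > 0"
  shows "complex_of_real (sqrt (2 * pi) ^ DIM('a)) * (\<integral>x. complex_of_real (gauss x) * v (z + \<epsilon> *\<^sub>R x) \<partial>lborel)
       = (\<integral>\<eta>. complex_of_real (gauss (\<epsilon> *\<^sub>R \<eta>)) * (cis (z \<bullet> \<eta>) * fourier v \<eta>) \<partial>lborel)"
proof -
  have [measurable]: "v \<in> borel_measurable borel"
    using borel_measurable_integrable[OF v] by simp
  let ?g = "\<lambda>x. complex_of_real (gauss x)"
  have "complex_of_real (sqrt (2 * pi) ^ DIM('a)) * (\<integral>x. ?g x * v (z + \<epsilon> *\<^sub>R x) \<partial>lborel)
    = (\<integral>x. complex_of_real (sqrt (2 * pi) ^ DIM('a)) * (?g x * v (z + \<epsilon> *\<^sub>R x)) \<partial>lborel)"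
    by (simp only: integral_mult_right_zero)
  also have "\<dots> = (\<integral>x. (\<integral>y. cis (y \<bullet> x) * ?g y \<partial>lborel) * v (z + \<epsilon> *\<^sub>R x) \<partial>lborel)"
    by (simp only: fourier_gauss of_real_mult mult.assoc)
  also have "\<dots> = (\<integral>x. (\<integral>y. cis (y \<bullet> x) * (v (z + \<epsilon> *\<^sub>R x) * ?g y) \<partial>lborel) \<partial>lborel)"
    by (intro Bochner_Integration.integral_cong refl, subst integral_mult_left_zero[symmetric]) (simp add: mult_ac)
  also have "\<dots> = (\<integral>y. (\<integral>x. cis (y \<bullet> x) * (v (z + \<epsilon> *\<^sub>R x) * ?g y) \<partial>lborel) \<partial>lborel)"
  proof (rule lborel_pair.Fubini_integral[symmetric])
    show "integrable (lborel \<Otimes>\<^sub>M lborel) (\<lambda>(x, y). cis (y \<bullet> x) * (v (z + \<epsilon> *\<^sub>R x) * ?g y))"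
      by (intro integrable_tensor_bound integrable_lborel_affine v fourier_gauss) (use \<epsilon> in \<open>auto simp: case_prod_beta\<close>)
  qed
  also have "\<dots> = (\<integral>y. ?g y * ((1 / \<epsilon>) ^ DIM('a) *\<^sub>R (cis (- ((y \<bullet> z) / \<epsilon>)) * fourier v (- (1 / \<epsilon>) *\<^sub>R y))) \<partial>lborel)"
  proof (rule Bochner_Integration.integral_cong[OF refl])
    fix y :: 'a
    \<comment> \<open>Substitution x = (w - z) / \<epsilon>: the translation becomes a phase and the
      dilation rescales the frequency.\<close>
    have "(\<integral>x. cis (y \<bullet> x) * v (z + \<epsilon> *\<^sub>R x) \<partial>lborel)
      = (1 / \<epsilon>) ^ DIM('a) *\<^sub>R (\<integral>w. cis (y \<bullet> (- (1 / \<epsilon>) *\<^sub>R z + (1 / \<epsilon>) *\<^sub>R w)) * v (z + \<epsilon> *\<^sub>R (- (1 / \<epsilon>) *\<^sub>R z + (1 / \<epsilon>) *\<^sub>R w)) \<partial>lborel)"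
      using integral_lborel_affine[of "\<lambda>x. cis (y \<bullet> x) * v (z + \<epsilon> *\<^sub>R x)" "1 / \<epsilon>" "- (1 / \<epsilon>) *\<^sub>R z"] \<epsilon> by simp
    also have "\<dots> = (1 / \<epsilon>) ^ DIM('a) *\<^sub>R (\<integral>w. cis (- ((y \<bullet> z) / \<epsilon>)) * (cis (- (w \<bullet> (- (1 / \<epsilon>) *\<^sub>R y))) * v w) \<partial>lborel)"
      using \<epsilon> by (intro arg_cong[where f="\<lambda>t. _ *\<^sub>R t"] Bochner_Integration.integral_cong refl)
        (simp add: algebra_simps cis_mult mult.assoc[symmetric] inner_commute)
    also have "\<dots> = (1 / \<epsilon>) ^ DIM('a) *\<^sub>R (cis (- ((y \<bullet> z) / \<epsilon>)) * fourier v (- (1 / \<epsilon>) *\<^sub>R y))"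
      by (simp only: integral_mult_right_zero fourier_def)
    finally show "(\<integral>x. cis (y \<bullet> x) * (v (z + \<epsilon> *\<^sub>R x) * ?g y) \<partial>lborel) = ?g y * ((1 / \<epsilon>) ^ DIM('a) *\<^sub>R (cis (- ((y \<bullet> z) / \<epsilon>)) * fourier v (- (1 / \<epsilon>) *\<^sub>R y)))"
      by (simp only: mult.assoc[symmetric] integral_mult_left_zero) (simp add: mult_ac)
  qed
  \<comment> \<open>Substitution y = - \<epsilon> \<eta>: the sign produces the phase of the inverse
    transform, and the Jacobian cancels the power of 1 / \<epsilon>.\<close>
  also have "\<dots> = \<epsilon> ^ DIM('a) *\<^sub>R (\<integral>\<eta>. ?g (\<epsilon> *\<^sub>R \<eta>) * ((1 / \<epsilon>) ^ DIM('a) *\<^sub>R (cis (z \<bullet> \<eta>) * fourier v \<eta>)) \<partial>lborel)"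
    using \<epsilon> by (subst integral_lborel_affine[of _ "- \<epsilon>" 0]) (simp_all add: gauss_def inner_commute)
  also have "\<dots> = (\<epsilon> ^ DIM('a) * (1 / \<epsilon>) ^ DIM('a)) *\<^sub>R (\<integral>\<eta>. ?g (\<epsilon> *\<^sub>R \<eta>) * (cis (z \<bullet> \<eta>) * fourier v \<eta>) \<partial>lborel)"
    by (simp only: mult_scaleR_right integral_scaleR_right scaleR_scaleR)
  also have "\<epsilon> ^ DIM('a) * (1 / \<epsilon>) ^ DIM('a) = 1"
    using \<epsilon> by (simp add: power_mult_distrib[symmetric])
  finally show ?thesis by simp
qed

text \<open>Let \<epsilon> tend to 0 in \<open>gaussian_average\<close>, with dominated convergence
  on both sides: B times the Gaussian dominates on the left, the modulus of \<open>fourier v\<close>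
  on the right. The constant is the square of (2 pi)^(n/2), which occurs once as the factor in
  \<open>gaussian_average\<close> and once as the total mass of \<open>gauss\<close>.\<close>

lemma fourier_inversion:
  fixes v :: "'a::euclidean_space \<Rightarrow> complex"
  assumes v: "integrable lborel v" and cont: "continuous_on UNIV v" and bdd: "\<And>z. norm (v z) \<le> B"
    and fv: "integrable lborel (fourier v)"
  shows "(\<integral>\<eta>. cis (z \<bullet> \<eta>) * fourier v \<eta> \<partial>lborel) = complex_of_real ((2 * pi) ^ DIM('a)) * v z"
proof -
  have [measurable]: "v \<in> borel_measurable borel"
    using borel_measurable_integrable[OF v] by simp
  let ?s = "complex_of_real (sqrt (2 * pi) ^ DIM('a))"
  define \<epsilon> where "\<epsilon> n = inverse (real (Suc n))" for n
  have \<epsilon>: "\<epsilon> n > 0" for n by (simp add: \<epsilon>_def)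
  have lim: "\<epsilon> \<longlonglongrightarrow> 0"
    unfolding \<epsilon>_def by (rule LIMSEQ_inverse_real_of_nat)
  have v_lim: "(\<lambda>n. v (z + \<epsilon> n *\<^sub>R x)) \<longlonglongrightarrow> v z" for x
  proof -
    have "(\<lambda>n. z + \<epsilon> n *\<^sub>R x) \<longlonglongrightarrow> z + 0 *\<^sub>R x"
      by (intro tendsto_intros lim)
    then show ?thesis
      using continuous_on_tendsto_compose[OF cont] by simp
  qed
  have g_lim: "(\<lambda>n. complex_of_real (gauss (\<epsilon> n *\<^sub>R \<eta>))) \<longlonglongrightarrow> 1" for \<eta> :: 'a
  proof -
    have "(\<lambda>n. \<epsilon> n *\<^sub>R \<eta>) \<longlonglongrightarrow> 0 *\<^sub>R \<eta>"
      by (intro tendsto_intros lim)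
    then have "(\<lambda>n. gauss (\<epsilon> n *\<^sub>R \<eta>)) \<longlonglongrightarrow> gauss (0::'a)"
      using continuous_on_tendsto_compose[OF gauss_continuous[of UNIV]] by simp
    then show ?thesis
      using tendsto_of_real by (fastforce simp: gauss_def)
  qed
  have "(\<lambda>n. \<integral>x. complex_of_real (gauss x) * v (z + \<epsilon> n *\<^sub>R x) \<partial>lborel) \<longlonglongrightarrow> (\<integral>x. complex_of_real (gauss (x::'a)) * v z \<partial>lborel)"
  proof (rule integral_dominated_convergence[where w="\<lambda>x. B * norm (complex_of_real (gauss x))"])
    show "integrable lborel (\<lambda>x::'a. B * norm (complex_of_real (gauss x)))"
      by (intro integrable_mult_right integrable_norm fourier_gauss)
    show "AE x in lborel. norm (complex_of_real (gauss x) * v (z + \<epsilon> n *\<^sub>R x)) \<le> B * norm (complex_of_real (gauss x))" for n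
      unfolding norm_mult by (subst mult.commute) (intro AE_I2 mult_right_mono bdd norm_ge_zero)
    show "AE x in lborel. (\<lambda>n. complex_of_real (gauss x) * v (z + \<epsilon> n *\<^sub>R x)) \<longlonglongrightarrow> complex_of_real (gauss x) * v z"
      by (intro AE_I2 tendsto_intros v_lim)
  qed measurable
  then have "(\<lambda>n. ?s * (\<integral>x. complex_of_real (gauss x) * v (z + \<epsilon> n *\<^sub>R x) \<partial>lborel)) \<longlonglongrightarrow> ?s * (\<integral>x. complex_of_real (gauss (x::'a)) * v z \<partial>lborel)"
    by (intro tendsto_intros)
  then have l1: "(\<lambda>n. \<integral>\<eta>. complex_of_real (gauss (\<epsilon> n *\<^sub>R \<eta>)) * (cis (z \<bullet> \<eta>) * fourier v \<eta>) \<partial>lborel) \<longlonglongrightarrow> ?s * (\<integral>x. complex_of_real (gauss (x::'a)) * v z \<partial>lborel)"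
    by (simp only: gaussian_average[OF v \<epsilon>])
  have l2: "(\<lambda>n. \<integral>\<eta>. complex_of_real (gauss (\<epsilon> n *\<^sub>R \<eta>)) * (cis (z \<bullet> \<eta>) * fourier v \<eta>) \<partial>lborel) \<longlonglongrightarrow> (\<integral>\<eta>. cis (z \<bullet> \<eta>) * fourier v \<eta> \<partial>lborel)"
  proof (rule integral_dominated_convergence[where w="\<lambda>\<eta>. norm (fourier v \<eta>)"])
    show "integrable lborel (\<lambda>\<eta>. norm (fourier v \<eta>))"
      by (intro integrable_norm fv)
    show "AE \<eta> in lborel. norm (complex_of_real (gauss (\<epsilon> n *\<^sub>R \<eta>)) * (cis (z \<bullet> \<eta>) * fourier v \<eta>)) \<le> norm (fourier v \<eta>)" for n
      by (intro AE_I2) (simp add: norm_mult mult_left_le_one_le gauss_le_1 abs_of_pos gauss_pos less_imp_le)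
    show "AE \<eta> in lborel. (\<lambda>n. complex_of_real (gauss (\<epsilon> n *\<^sub>R \<eta>)) * (cis (z \<bullet> \<eta>) * fourier v \<eta>)) \<longlonglongrightarrow> cis (z \<bullet> \<eta>) * fourier v \<eta>"
      using tendsto_mult_right[OF g_lim] by (intro AE_I2) fastforce
  qed measurable
  have "(\<integral>x. complex_of_real (gauss (x::'a)) \<partial>lborel) = ?s"
    using fourier_gauss(1)[of "0::'a"] by (simp add: gauss_def)
  then have "?s * (\<integral>x. complex_of_real (gauss (x::'a)) * v z \<partial>lborel) = (?s * ?s) * v z"
    by (simp only: integral_mult_left_zero mult.assoc)
  also have "?s * ?s = complex_of_real ((2 * pi) ^ DIM('a))"
    by (simp only: of_real_mult[symmetric] power_mult_distrib[symmetric]) simp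
  finally show ?thesis
    using LIMSEQ_unique[OF l1 l2] by (simp only:)
qed

text \<open>Only v is replaced by its inversion integral, which is why the stronger assumptions fall
  on v while u is merely integrable.\<close>

lemma fourier_mult:
  fixes u v :: "'a::euclidean_space \<Rightarrow> complex"
  assumes u: "integrable lborel u" and v: "integrable lborel v" and cont: "continuous_on UNIV v" and bdd: "\<And>z. norm (v z) \<le> B"
    and fv: "integrable lborel (fourier v)"
  shows "complex_of_real ((2 * pi) ^ DIM('a)) * fourier (\<lambda>z. u z * v z) \<zeta> = (\<integral>\<eta>. fourier u (\<zeta> - \<eta>) * fourier v \<eta> \<partial>lborel)"
proof -
  have [measurable]: "u \<in> borel_measurable borel" "v \<in> borel_measurable borel"
    using borel_measurable_integrable[OF u] borel_measurable_integrable[OF v] by simp_all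
  have "complex_of_real ((2 * pi) ^ DIM('a)) * fourier (\<lambda>z. u z * v z) \<zeta>
     = (\<integral>z. complex_of_real ((2 * pi) ^ DIM('a)) * (cis (- (z \<bullet> \<zeta>)) * (u z * v z)) \<partial>lborel)"
    by (simp only: fourier_def integral_mult_right_zero)
  also have "\<dots> = (\<integral>z. cis (- (z \<bullet> \<zeta>)) * u z * (complex_of_real ((2 * pi) ^ DIM('a)) * v z) \<partial>lborel)"
    by (simp only: mult_ac)
  also have "\<dots> = (\<integral>z. (\<integral>\<eta>. cis (- (z \<bullet> \<zeta>)) * u z * (cis (z \<bullet> \<eta>) * fourier v \<eta>) \<partial>lborel) \<partial>lborel)"
    by (simp only: fourier_inversion[OF v cont bdd fv, symmetric] integral_mult_right_zero)
  also have "\<dots> = (\<integral>z. (\<integral>\<eta>. cis (- (z \<bullet> (\<zeta> - \<eta>))) * (u z * fourier v \<eta>) \<partial>lborel) \<partial>lborel)"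
  proof -
    have "cis (- (z \<bullet> (\<zeta> - \<eta>))) = cis (- (z \<bullet> \<zeta>)) * cis (z \<bullet> \<eta>)" for z \<eta>
      by (simp add: cis_mult inner_diff_right)
    then show ?thesis
      by (intro Bochner_Integration.integral_cong refl) (simp only: mult_ac)
  qed
  also have "\<dots> = (\<integral>\<eta>. (\<integral>z. cis (- (z \<bullet> (\<zeta> - \<eta>))) * (u z * fourier v \<eta>) \<partial>lborel) \<partial>lborel)"
  proof (rule lborel_pair.Fubini_integral[symmetric])
    show "integrable (lborel \<Otimes>\<^sub>M lborel) (\<lambda>(z, \<eta>). cis (- (z \<bullet> (\<zeta> - \<eta>))) * (u z * fourier v \<eta>))"
      by (intro integrable_tensor_bound u fv) (auto simp: case_prod_beta)
  qed
  also have "\<dots> = (\<integral>\<eta>. fourier u (\<zeta> - \<eta>) * fourier v \<eta> \<partial>lborel)"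
    by (simp only: mult.assoc[symmetric] integral_mult_left_zero fourier_def)
  finally show ?thesis .
qed

lemma norm_fourier_mult_le:
  fixes u v :: "'a::euclidean_space \<Rightarrow> complex"
  assumes u: "integrable lborel u" and v: "integrable lborel v" and cont: "continuous_on UNIV v" and bdd: "\<And>z. norm (v z) \<le> B"
    and fv: "integrable lborel (fourier v)"
  shows "ennreal (norm (fourier (\<lambda>z. u z * v z) \<zeta>)) \<le> (\<integral>\<^sup>+\<eta>. ennreal (norm (fourier u (\<zeta> - \<eta>))) * ennreal (norm (fourier v \<eta>)) \<partial>lborel)"
proof -
  have [measurable]: "u \<in> borel_measurable borel" "v \<in> borel_measurable borel"
    using borel_measurable_integrable[OF u] borel_measurable_integrable[OF v] by simp_all
  have int: "integrable lborel (\<lambda>\<eta>. fourier u (\<zeta> - \<eta>) * fourier v \<eta>)"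
  proof (rule Bochner_Integration.integrable_bound)
    show "integrable lborel (\<lambda>\<eta>. (\<integral>z. norm (u z) \<partial>lborel) * norm (fourier v \<eta>))"
      by (intro integrable_mult_right integrable_norm fv)
    have "norm (fourier u (\<zeta> - \<eta>)) * norm (fourier v \<eta>) \<le> \<bar>\<integral>z. norm (u z) \<partial>lborel\<bar> * norm (fourier v \<eta>)" for \<eta>
      by (intro mult_right_mono order_trans[OF norm_fourier_le[OF u]]) auto
    then show "AE \<eta> in lborel. norm (fourier u (\<zeta> - \<eta>) * fourier v \<eta>) \<le> norm ((\<integral>z. norm (u z) \<partial>lborel) * norm (fourier v \<eta>))"
      by (intro AE_I2) (simp add: norm_mult abs_mult)
  qed measurable
  have "(1::real) \<le> (2 * pi) ^ DIM('a)"
    using pi_gt3 by (intro one_le_power) simp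
  then have "norm (fourier (\<lambda>z. u z * v z) \<zeta>) \<le> (2 * pi) ^ DIM('a) * norm (fourier (\<lambda>z. u z * v z) \<zeta>)"
    using mult_right_mono[of 1 "(2 * pi) ^ DIM('a)" "norm (fourier (\<lambda>z. u z * v z) \<zeta>)"] by simp
  also have "\<dots> = norm (complex_of_real ((2 * pi) ^ DIM('a)) * fourier (\<lambda>z. u z * v z) \<zeta>)"
    by (simp only: norm_mult norm_of_real) simp
  also have "\<dots> = norm (\<integral>\<eta>. fourier u (\<zeta> - \<eta>) * fourier v \<eta> \<partial>lborel)"
    by (simp only: fourier_mult[OF assms])
  finally have "ennreal (norm (fourier (\<lambda>z. u z * v z) \<zeta>)) \<le> ennreal (norm (\<integral>\<eta>. fourier u (\<zeta> - \<eta>) * fourier v \<eta> \<partial>lborel))"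
    by (rule ennreal_leI)
  also have "\<dots> \<le> (\<integral>\<^sup>+\<eta>. ennreal (norm (fourier u (\<zeta> - \<eta>) * fourier v \<eta>)) \<partial>lborel)"
    by (rule integral_norm_bound_ennreal[OF int])
  finally show ?thesis
    by (simp add: norm_mult ennreal_mult)
qed

section \<open>Schwartz functions\<close>

lemma derivs_trans: "g \<in> derivs h \<Longrightarrow> h \<in> derivs f \<Longrightarrow> g \<in> derivs f"
  by (induction rule: derivs.induct) (auto intro: derivs.intros)

lemma schwartz_differentiable: "schwartz f \<Longrightarrow> f differentiable (at z)"
  unfolding schwartz_def using derivs.self by blast

lemma schwartz_frechet_derivative:
  assumes "schwartz f" "v \<in> Basis"
  shows "schwartz (\<lambda>z. frechet_derivative f (at z) v)"
proof -
  have "(\<lambda>z. frechet_derivative f (at z) v) \<in> derivs f"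
    using assms by (intro derivs.step derivs.self allI schwartz_differentiable)
  then show ?thesis
    using assms(1) derivs_trans unfolding schwartz_def by blast
qed

lemma schwartz_continuous: "schwartz f \<Longrightarrow> continuous_on S f"
  by (meson schwartz_differentiable differentiable_imp_continuous_within continuous_at_imp_continuous_on)

lemma schwartz_measurable: "schwartz f \<Longrightarrow> f \<in> borel_measurable borel"
  by (intro borel_measurable_continuous_onI schwartz_continuous)

lemma schwartz_decay:
  fixes q :: real
  assumes "schwartz f"
  shows "\<exists>C. \<forall>z. norm (f z) \<le> C * jbr z powr (- q)"
proof -
  define N where "N = nat \<lceil>q\<rceil>"
  have N: "q \<le> real N" by (simp add: N_def) linarith
  have "bounded (range (\<lambda>z. (1 + norm z) ^ N * norm (f z)))"
    using assms derivs.self unfolding schwartz_def by blast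
  then obtain C where C: "\<And>z. norm ((1 + norm z) ^ N * norm (f z)) \<le> C"
    unfolding bounded_iff by blast
  have "norm (f z) \<le> C * jbr z powr (- q)" for z
  proof -
    have "jbr z powr q \<le> jbr z powr (real N)"
      using N jbr_ge_1[of z] by (intro powr_mono) auto
    also have "\<dots> = jbr z ^ N"
      using jbr_pos[of z] by (simp add: powr_realpow)
    also have "\<dots> \<le> (1 + norm z) ^ N"
      using jbr_le[of z] jbr_pos[of z] by (intro power_mono) auto
    finally have "jbr z powr q * norm (f z) \<le> (1 + norm z) ^ N * norm (f z)"
      by (intro mult_right_mono) auto
    also have "\<dots> \<le> C"
      using C[of z] by simp
    finally show ?thesis
      using jbr_pos[of z] by (simp add: powr_minus divide_simps mult.commute)
  qed
  then show ?thesis by blast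
qed

lemma schwartz_bounded: "schwartz f \<Longrightarrow> \<exists>B. \<forall>z. norm (f z) \<le> B"
  using schwartz_decay[of f 0] by simp

lemma schwartz_integrable:
  fixes f :: "'a::euclidean_space \<Rightarrow> complex"
  assumes "schwartz f"
  shows "integrable lborel f"
proof -
  obtain C where "\<And>z. norm (f z) \<le> C * jbr z powr (- (real DIM('a) + 1))"
    using schwartz_decay[OF assms] by blast
  then show ?thesis
    by (rule integrable_lborel_jbr_bound[OF schwartz_measurable[OF assms], rotated]) simp
qed

text \<open>By the fundamental theorem of calculus and Fubini, the integral equals that of
  \<open>w (z + v) - w z\<close>, which vanishes by translation invariance.\<close>

lemma integral_directional_derivative:
  fixes w :: "'a::euclidean_space \<Rightarrow> complex"
  assumes w: "integrable lborel w" and deriv: "\<And>z. (w has_derivative w' z) (at z)"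
    and cont: "continuous_on UNIV (\<lambda>z. w' z v)" and int: "integrable lborel (\<lambda>z. w' z v)"
  shows "(\<integral>z. w' z v \<partial>lborel) = 0"
proof -
  define D where "D z = w' z v" for z
  have D: "continuous_on UNIV D" "integrable lborel D"
    using cont int by (simp_all add: D_def[abs_def])
  have [measurable]: "w \<in> borel_measurable borel" "D \<in> borel_measurable borel"
    using borel_measurable_integrable[OF w] borel_measurable_integrable[OF D(2)] by simp_all
  have sh_int: "integrable lborel (\<lambda>z. f (z + c))" and sh: "(\<integral>z. f (z + c) \<partial>lborel) = (\<integral>z. f z \<partial>lborel)"
    if f: "integrable lborel f" for f :: "'a \<Rightarrow> complex" and c
    using integrable_lborel_affine[OF f, of 1 c] integral_lborel_affine[of f 1 c] borel_measurable_integrable[OF f]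
    by (simp_all add: add.commute)
  have ftc: "(\<integral>t. indicator {0..1} t *\<^sub>R D (z + t *\<^sub>R v) \<partial>lborel) = w (z + v) - w z" for z
  proof -
    have "(\<integral>t. indicator {0..1} t *\<^sub>R D (z + t *\<^sub>R v) \<partial>lborel) = w (z + 1 *\<^sub>R v) - w (z + 0 *\<^sub>R v)"
    proof (rule integral_FTC_atLeastAtMost)
      fix t :: real
      have "((\<lambda>t. w (z + t *\<^sub>R v)) has_derivative (\<lambda>h. w' (z + t *\<^sub>R v) (h *\<^sub>R v))) (at t within {0..1})"
        by (rule has_derivative_compose[OF _ deriv]) (auto intro!: derivative_eq_intros)
      moreover have "w' (z + t *\<^sub>R v) (h *\<^sub>R v) = h *\<^sub>R D (z + t *\<^sub>R v)" for h
        unfolding D_def using linear_scale[OF has_derivative_linear[OF deriv]] .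
      ultimately show "((\<lambda>t. w (z + t *\<^sub>R v)) has_vector_derivative D (z + t *\<^sub>R v)) (at t within {0..1})"
        by (simp add: has_vector_derivative_def)
    next
      show "continuous_on {0..1} (\<lambda>t. D (z + t *\<^sub>R v))"
        by (intro continuous_on_compose2[OF D(1)] continuous_intros) auto
    qed simp
    then show ?thesis by simp
  qed
  \<comment> \<open>The integral of the norm over z is independent of t by translation invariance,
    and t is confined to [0, 1].\<close>
  have intD: "integrable (lborel \<Otimes>\<^sub>M lborel) (\<lambda>(t, z). indicator {0..1} t *\<^sub>R D (z + t *\<^sub>R v))"
  proof (rule lborel_pair.Fubini_integrable)
    have "(\<integral>z. norm (D (z + t *\<^sub>R v)) \<partial>lborel) = (\<integral>z. norm (D z) \<partial>lborel)" for t
      using integral_lborel_affine[of "\<lambda>z. norm (D z)" 1 "t *\<^sub>R v"] by (simp add: add.commute)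
    then have "(\<lambda>t. \<integral>z. norm (case (t, z) of (t, z) \<Rightarrow> indicator {0..1} t *\<^sub>R D (z + t *\<^sub>R v)) \<partial>lborel) = (\<lambda>t::real. indicator {0..1} t *\<^sub>R (\<integral>z. norm (D z) \<partial>lborel))"
      by (auto simp: indicator_def)
    then show "integrable lborel (\<lambda>t::real. \<integral>z. norm (case (t, z) of (t, z) \<Rightarrow> indicator {0..1} t *\<^sub>R D (z + t *\<^sub>R v)) \<partial>lborel)"
      by (simp only:) (intro integrable_real_indicator integrable_scaleR_left, auto)
    show "AE t in lborel. integrable lborel (\<lambda>z. case (t, z) of (t, z) \<Rightarrow> indicator {0..1::real} t *\<^sub>R D (z + t *\<^sub>R v))"
      using sh_int[OF D(2)] by (intro AE_I2) simp
  qed measurable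
  have "(\<integral>z. w (z + v) - w z \<partial>lborel) = (\<integral>z. (\<integral>t. indicator {0..1} t *\<^sub>R D (z + t *\<^sub>R v) \<partial>lborel) \<partial>lborel)"
    by (simp only: ftc)
  also have "\<dots> = (\<integral>t. (\<integral>z. indicator {0..1} t *\<^sub>R D (z + t *\<^sub>R v) \<partial>lborel) \<partial>lborel)"
    by (rule lborel_pair.Fubini_integral[OF intD])
  also have "\<dots> = (\<integral>t. indicator {0..1::real} t *\<^sub>R (\<integral>z. D z \<partial>lborel) \<partial>lborel)"
    by (simp only: integral_scaleR_right sh[OF D(2)])
  also have "\<dots> = (\<integral>z. D z \<partial>lborel)"
    by (subst integral_scaleR_left) auto
  finally show ?thesis
    using sh_int[OF w] sh[OF w] w by (simp add: D_def[abs_def])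
qed

text \<open>Integration by parts: the derivative of \<open>w\<close>, which is u times the
  exponential, integrates to 0 by \<open>integral_directional_derivative\<close>, and the product
  rule splits it into the two terms.\<close>

lemma fourier_frechet_derivative:
  fixes u :: "'a::euclidean_space \<Rightarrow> complex"
  assumes u: "schwartz u" and v: "v \<in> Basis"
  shows "fourier (\<lambda>z. frechet_derivative u (at z) v) \<zeta> = \<i> * complex_of_real (v \<bullet> \<zeta>) * fourier u \<zeta>"
proof -
  let ?D = "\<lambda>z. frechet_derivative u (at z) v"
  define w where "w z = cis (- (z \<bullet> \<zeta>)) * u z" for z
  define w' where "w' z h = cis (- (z \<bullet> \<zeta>)) * frechet_derivative u (at z) h - \<i> * complex_of_real (h \<bullet> \<zeta>) * w z" for z h
  have sD: "schwartz ?D" by (rule schwartz_frechet_derivative[OF u v])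
  have ud: "(u has_derivative frechet_derivative u (at z)) (at z)" for z
    using schwartz_differentiable[OF u] frechet_derivative_works by blast
  have w: "integrable lborel w"
    unfolding w_def by (intro integrable_cis_mult schwartz_integrable u) auto
  have D: "integrable lborel (\<lambda>z. cis (- (z \<bullet> \<zeta>)) * ?D z)"
    by (intro integrable_cis_mult schwartz_integrable sD) auto
  have deriv: "(w has_derivative w' z) (at z)" for z
  proof -
    have cis': "((\<lambda>z. cis (- (z \<bullet> \<zeta>))) has_derivative (\<lambda>h. - (h \<bullet> \<zeta>) *\<^sub>R (\<i> * cis (- (z \<bullet> \<zeta>))))) (at z)"
      by (auto intro!: derivative_eq_intros)
    show ?thesis
      unfolding w_def[abs_def] w'_def[abs_def]
      by (rule has_derivative_eq_rhs[OF has_derivative_mult[OF cis' ud]])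
        (auto simp: scaleR_conv_of_real algebra_simps)
  qed
  have cont: "continuous_on UNIV (\<lambda>z. w' z v)"
    unfolding w'_def w_def
    by (intro continuous_intros schwartz_continuous[OF sD] schwartz_continuous[OF u])
  have int: "integrable lborel (\<lambda>z. w' z v)"
    unfolding w'_def by (intro Bochner_Integration.integrable_diff integrable_mult_right D w)
  have "0 = (\<integral>z. w' z v \<partial>lborel)"
    by (rule integral_directional_derivative[OF w deriv cont int, symmetric])
  also have "\<dots> = fourier ?D \<zeta> - \<i> * complex_of_real (v \<bullet> \<zeta>) * fourier u \<zeta>"
    unfolding w'_def
    by (subst Bochner_Integration.integral_diff[OF D integrable_mult_right[OF w]])
      (simp add: fourier_def w_def)
  finally show ?thesis by simp
qed

text \<open>Each derivative in direction v yields one more factor of the component on the Fourier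
  side. The derivative is again Schwartz, so the induction runs over all u at once, starting from
  the L^1 bound.\<close>

lemma fourier_component_decay:
  fixes u :: "'a::euclidean_space \<Rightarrow> complex"
  assumes "schwartz u" "v \<in> Basis"
  shows "\<exists>C. \<forall>\<zeta>. \<bar>v \<bullet> \<zeta>\<bar> ^ N * norm (fourier u \<zeta>) \<le> C"
  using assms(1)
proof (induction N arbitrary: u)
  case 0
  then show ?case using norm_fourier_le[OF schwartz_integrable[OF 0]] by auto
next
  case (Suc N)
  obtain C where "\<And>\<zeta>. \<bar>v \<bullet> \<zeta>\<bar> ^ N * norm (fourier (\<lambda>z. frechet_derivative u (at z) v) \<zeta>) \<le> C"
    using Suc.IH[OF schwartz_frechet_derivative[OF Suc.prems assms(2)]] by blast
  then show ?case
    by (intro exI[of _ C]) (simp add: fourier_frechet_derivative[OF Suc.prems assms(2)] norm_mult mult_ac)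
qed

text \<open>Decay in single coordinates suffices because some coordinate of \<zeta> carries at least
  the fraction 1/n of its norm. Which one depends on \<zeta>, so the bounds \<open>M v\<close> are
  summed over the basis.\<close>

lemma fourier_decay:
  fixes u :: "'a::euclidean_space \<Rightarrow> complex" and q :: real
  assumes u: "schwartz u"
  shows "\<exists>C. \<forall>\<zeta>. norm (fourier u \<zeta>) \<le> C * jbr \<zeta> powr (- q)"
proof -
  define N where "N = nat \<lceil>q\<rceil>"
  have N: "q \<le> real N" by (simp add: N_def) linarith
  define n where "n = real DIM('a)"
  have n: "n \<ge> 1" using DIM_positive[where 'a='a] by (simp add: n_def)
  obtain M where M: "\<And>v \<zeta>. v \<in> Basis \<Longrightarrow> \<bar>v \<bullet> \<zeta>\<bar> ^ N * norm (fourier u \<zeta>) \<le> M v"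
  proof -
    have "\<forall>v\<in>Basis. \<exists>C. \<forall>\<zeta>. \<bar>v \<bullet> \<zeta>\<bar> ^ N * norm (fourier u \<zeta>) \<le> C"
      using fourier_component_decay[OF u] by blast
    from bchoice[OF this] show ?thesis using that by blast
  qed
  obtain M0 where M0: "\<And>\<zeta>. norm (fourier u \<zeta>) \<le> M0"
    using norm_fourier_le[OF schwartz_integrable[OF u]] by blast
  have "norm (fourier u \<zeta>) \<le> ((1 + n) ^ N * (M0 + (\<Sum>v\<in>Basis. M v))) * jbr \<zeta> powr (- q)" for \<zeta>
  proof -
    have "\<exists>v\<in>Basis. norm \<zeta> \<le> n * \<bar>v \<bullet> \<zeta>\<bar>"
    proof (rule ccontr)
      assume "\<not> ?thesis"
      then have "\<bar>\<zeta> \<bullet> v\<bar> < norm \<zeta> / n" if "v \<in> Basis" for v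
        using that n by (fastforce simp: field_simps inner_commute)
      then have "(\<Sum>v\<in>Basis. \<bar>\<zeta> \<bullet> v\<bar>) < (\<Sum>v\<in>(Basis::'a set). norm \<zeta> / n)"
        by (intro sum_strict_mono) auto
      also have "\<dots> = norm \<zeta>" using n by (simp add: n_def)
      finally show False using norm_le_l1[of \<zeta>] by simp
    qed
    then obtain v where v: "v \<in> Basis" "norm \<zeta> \<le> n * \<bar>v \<bullet> \<zeta>\<bar>" by blast
    \<comment> \<open>The maximum with 1 covers frequencies near the origin: the summand 1 it leads
      to is paired with the uniform bound \<open>M0\<close>.\<close>
    let ?m = "max 1 \<bar>v \<bullet> \<zeta>\<bar>"
    have "n * \<bar>v \<bullet> \<zeta>\<bar> \<le> n * ?m" using n by (intro mult_left_mono) auto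
    then have "jbr \<zeta> \<le> ?m + n * ?m"
      using jbr_le[of \<zeta>] v(2) by linarith
    then have le: "jbr \<zeta> \<le> (1 + n) * ?m" by (simp add: algebra_simps)
    have "jbr \<zeta> powr q \<le> jbr \<zeta> powr (real N)"
      using N jbr_ge_1[of \<zeta>] by (intro powr_mono) auto
    also have "\<dots> = jbr \<zeta> ^ N"
      using jbr_pos[of \<zeta>] by (simp add: powr_realpow)
    also have "\<dots> \<le> ((1 + n) * ?m) ^ N"
      using le jbr_pos[of \<zeta>] by (intro power_mono) auto
    also have "\<dots> \<le> (1 + n) ^ N * (1 + \<bar>v \<bullet> \<zeta>\<bar> ^ N)"
      unfolding power_mult_distrib using n by (intro mult_left_mono) (auto simp: max_def)
    finally have "jbr \<zeta> powr q * norm (fourier u \<zeta>) \<le> (1 + n) ^ N * (1 + \<bar>v \<bullet> \<zeta>\<bar> ^ N) * norm (fourier u \<zeta>)"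
      by (intro mult_right_mono) auto
    also have "\<dots> = (1 + n) ^ N * (norm (fourier u \<zeta>) + \<bar>v \<bullet> \<zeta>\<bar> ^ N * norm (fourier u \<zeta>))"
      by (simp add: algebra_simps)
    also have "\<dots> \<le> (1 + n) ^ N * (M0 + (\<Sum>v\<in>Basis. M v))"
    proof (intro mult_left_mono add_mono M0)
      have "0 \<le> M v" if "v \<in> Basis" for v
        using M[OF that, of 0] by (rule order_trans[rotated]) simp
      then have "M v \<le> (\<Sum>v\<in>Basis. M v)"
        using v(1) by (intro member_le_sum) auto
      then show "\<bar>v \<bullet> \<zeta>\<bar> ^ N * norm (fourier u \<zeta>) \<le> (\<Sum>v\<in>Basis. M v)"
        using M[OF v(1), of \<zeta>] by linarith
    qed (use n in auto)
    finally show ?thesis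
      using jbr_pos[of \<zeta>] by (simp add: powr_minus divide_simps mult.commute)
  qed
  then show ?thesis by blast
qed

section \<open>The product estimate\<close>

lemma ft_eq_fourier: "ft u = fourier u"
  by (rule ext) (simp add: ft_def fourier_def case_prod_beta' inner_prod_def)

lemma powr_le_powr_abs:
  fixes a c :: real
  assumes "1 \<le> a" "a \<le> c"
  shows "a powr s \<le> c powr \<bar>s\<bar>"
proof -
  have "a powr s \<le> a powr \<bar>s\<bar>" using assms by (intro powr_mono) auto
  also have "\<dots> \<le> c powr \<bar>s\<bar>" using assms by (intro powr_mono2) auto
  finally show ?thesis .
qed

text \<open>Crude, but any polynomial bound is enough against the rapid decay of transforms of
  Schwartz functions.\<close>

lemma wave_weight_le:
  fixes p :: "real \<times> 'a::real_normed_vector"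
  shows "jbr (snd p) powr s * jbr (\<bar>fst p\<bar> - norm (snd p)) powr b \<le> jbr p powr (\<bar>s\<bar> + \<bar>b\<bar>)"
proof -
  have n: "\<bar>fst p\<bar> \<le> norm p" "norm (snd p) \<le> norm p"
    using norm_fst_le[of "fst p" "snd p"] norm_snd_le[of "snd p" "fst p"] by simp_all
  have le: "\<bar>\<bar>fst p\<bar> - norm (snd p)\<bar> \<le> norm p"
    using n norm_ge_zero[of "snd p"] abs_ge_zero[of "fst p"] by linarith
  have "jbr (snd p) powr s * jbr (\<bar>fst p\<bar> - norm (snd p)) powr b \<le> jbr p powr \<bar>s\<bar> * jbr p powr \<bar>b\<bar>"
    using n le by (intro mult_mono powr_le_powr_abs jbr_ge_1 jbr_mono) auto
  then show ?thesis by (simp add: powr_add)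
qed

text \<open>Needed because \<^const>\<open>hsb_norm\<close> sends an infinite integral to 0.\<close>

lemma schwartz_hsb_finite:
  fixes u :: "real \<times> (real^'n) \<Rightarrow> complex"
  assumes "schwartz u"
  shows "(\<integral>\<^sup>+p. ennreal ((jbr (snd p) powr s * jbr (\<bar>fst p\<bar> - norm (snd p)) powr b * cmod (ft u p))\<^sup>2) \<partial>lborel) < \<infinity>"
proof -
  define m where "m = real DIM(real \<times> (real^'n))"
  have m: "m > 0" by (simp add: m_def)
  \<comment> \<open>The part |s| + |b| of the exponent absorbs the weights; the remaining dimension
    m becomes 2 m after squaring, above the integrability threshold m.\<close>
  obtain C where C: "\<And>p. norm (fourier u p) \<le> C * jbr p powr (- (\<bar>s\<bar> + \<bar>b\<bar> + m))"
    using fourier_decay[OF assms] by blast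
  obtain J where J: "(\<integral>\<^sup>+p. ennreal (jbr (p :: real \<times> (real^'n)) powr (- (2 * m))) \<partial>lborel) \<le> ennreal J"
    using nn_integral_jbr_finite_euclidean[of "2 * m", where 'a="real \<times> (real^'n)"] m m_def by auto
  have "(jbr (snd p) powr s * jbr (\<bar>fst p\<bar> - norm (snd p)) powr b * cmod (ft u p))\<^sup>2 \<le> C\<^sup>2 * jbr p powr (- (2 * m))" for p
  proof -
    have "jbr (snd p) powr s * jbr (\<bar>fst p\<bar> - norm (snd p)) powr b * cmod (ft u p)
       \<le> jbr p powr (\<bar>s\<bar> + \<bar>b\<bar>) * (C * jbr p powr (- (\<bar>s\<bar> + \<bar>b\<bar> + m)))"
      unfolding ft_eq_fourier by (intro mult_mono wave_weight_le C) auto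
    also have "\<dots> = C * (jbr p powr (\<bar>s\<bar> + \<bar>b\<bar>) * jbr p powr (- (\<bar>s\<bar> + \<bar>b\<bar> + m)))"
      by simp
    also have "jbr p powr (\<bar>s\<bar> + \<bar>b\<bar>) * jbr p powr (- (\<bar>s\<bar> + \<bar>b\<bar> + m)) = jbr p powr (- m)"
      by (simp add: powr_add[symmetric])
    finally have "(jbr (snd p) powr s * jbr (\<bar>fst p\<bar> - norm (snd p)) powr b * cmod (ft u p))\<^sup>2 \<le> (C * jbr p powr (- m))\<^sup>2"
      by (rule power_mono) simp
    also have "\<dots> = C\<^sup>2 * jbr p powr (- (2 * m))"
      by (simp add: power_mult_distrib power2_eq_square[of "jbr p powr (- m)"] powr_add[symmetric])
    finally show ?thesis .
  qed
  then have "(\<integral>\<^sup>+p. ennreal ((jbr (snd p) powr s * jbr (\<bar>fst p\<bar> - norm (snd p)) powr b * cmod (ft u p))\<^sup>2) \<partial>lborel)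
     \<le> (\<integral>\<^sup>+p. ennreal (C\<^sup>2) * ennreal (jbr (p :: real \<times> (real^'n)) powr (- (2 * m))) \<partial>lborel)"
    by (intro nn_integral_mono) (simp add: ennreal_mult[symmetric] ennreal_leI)
  also have "\<dots> \<le> ennreal (C\<^sup>2) * ennreal J"
    by (subst nn_integral_cmult) (auto intro!: mult_left_mono J)
  also have "\<dots> < \<infinity>"
    by (simp add: ennreal_mult_less_top)
  finally show ?thesis .
qed

lemma is_product_trivial_b:
  fixes s0 s1 s2 b2 :: real
  assumes "b2 > 1/2"
    and "s0 + s1 + s2 \<ge> CARD('n::finite) / 2"
    and "s0 + s1 + s2 \<ge> max s0 (max s1 s2)"
    and "\<not> (s0 + s1 + s2 = CARD('n) / 2 \<and> s0 + s1 + s2 = max s0 (max s1 s2))"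
  shows "is_product TYPE('n) s0 s1 s2 0 0 b2"
proof -
  define I where "I s b u = (\<integral>\<^sup>+p. ennreal ((jbr (snd p) powr s * jbr (\<bar>fst p\<bar> - norm (snd p)) powr b * cmod (ft u p))\<^sup>2) \<partial>lborel)"
    for s b and u :: "real \<times> (real^'n) \<Rightarrow> complex"
  obtain K where K: "K \<ge> 0" "\<And>U V :: real \<times> (real^'n) \<Rightarrow> ennreal.
     U \<in> borel_measurable borel \<Longrightarrow> V \<in> borel_measurable borel \<Longrightarrow>
     (\<integral>\<^sup>+p. (ennreal (jbr (snd p) powr (- s0)) * (\<integral>\<^sup>+q. U (p - q) * V q \<partial>lborel))\<^sup>2 \<partial>lborel)
      \<le> ennreal K * ((\<integral>\<^sup>+p. (ennreal (jbr (snd p) powr s1) * U p)\<^sup>2 \<partial>lborel) *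
          (\<integral>\<^sup>+p. (ennreal (jbr (snd p) powr s2 * jbr (\<bar>fst p\<bar> - norm (snd p)) powr b2) * V p)\<^sup>2 \<partial>lborel))"
    using wave_sobolev_convolution[of b2 s0 s1 s2, where 'a="real^'n"] assms by auto
  have "hsb_norm (- s0) (- 0) (\<lambda>z. u z * v z) \<le> sqrt K * hsb_norm s1 0 u * hsb_norm s2 b2 v"
    if u: "schwartz u" and v: "schwartz v" for u v :: "real \<times> (real^'n) \<Rightarrow> complex"
  proof -
    have [measurable]: "u \<in> borel_measurable borel" "v \<in> borel_measurable borel"
      using schwartz_measurable u v by blast+
    obtain C where "\<And>p. norm (fourier v p) \<le> C * jbr p powr (- (real DIM(real \<times> (real^'n)) + 1))"
      using fourier_decay[OF v] by blast
    then have fv: "integrable lborel (fourier v)"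
      by (rule integrable_lborel_jbr_bound[rotated 2]) auto
    obtain B where B: "\<And>z. norm (v z) \<le> B"
      using schwartz_bounded[OF v] by blast
    define U V where "U p = ennreal (norm (fourier u p))" and "V p = ennreal (norm (fourier v p))" for p
    have [measurable]: "U \<in> borel_measurable borel" "V \<in> borel_measurable borel"
      unfolding U_def V_def by measurable
    have conv: "ennreal (norm (fourier (\<lambda>z. u z * v z) p)) \<le> (\<integral>\<^sup>+q. U (p - q) * V q \<partial>lborel)" for p
      unfolding U_def V_def
      by (rule norm_fourier_mult_le[OF schwartz_integrable[OF u] schwartz_integrable[OF v] schwartz_continuous[OF v] B fv])
    have "I (- s0) (- 0) (\<lambda>z. u z * v z) = (\<integral>\<^sup>+p. (ennreal (jbr (snd p) powr (- s0)) * ennreal (norm (fourier (\<lambda>z. u z * v z) p)))\<^sup>2 \<partial>lborel)"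
      by (simp add: I_def ft_eq_fourier ennreal_power ennreal_mult[symmetric])
    also have "\<dots> \<le> (\<integral>\<^sup>+p. (ennreal (jbr (snd p) powr (- s0)) * (\<integral>\<^sup>+q. U (p - q) * V q \<partial>lborel))\<^sup>2 \<partial>lborel)"
      by (intro nn_integral_mono power_mono mult_left_mono conv) auto
    also have "\<dots> \<le> ennreal K * ((\<integral>\<^sup>+p. (ennreal (jbr (snd p) powr s1) * U p)\<^sup>2 \<partial>lborel) *
          (\<integral>\<^sup>+p. (ennreal (jbr (snd p) powr s2 * jbr (\<bar>fst p\<bar> - norm (snd p)) powr b2) * V p)\<^sup>2 \<partial>lborel))"
      by (rule K) measurable
    also have "\<dots> = ennreal K * (I s1 0 u * I s2 b2 v)"
      by (simp add: I_def ft_eq_fourier U_def V_def ennreal_power ennreal_mult[symmetric])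
    finally have le: "I (- s0) (- 0) (\<lambda>z. u z * v z) \<le> ennreal K * (I s1 0 u * I s2 b2 v)" .
    \<comment> \<open>\<open>enn2real\<close> is monotone only below \<open>top\<close>: an infinite
      right side would be sent to 0 and the real inequality could fail.\<close>
    have "I s1 0 u < \<infinity>" "I s2 b2 v < \<infinity>"
      unfolding I_def by (intro schwartz_hsb_finite u v)+
    then have "ennreal K * (I s1 0 u * I s2 b2 v) < top"
      by (simp add: ennreal_mult_less_top)
    with le have "enn2real (I (- s0) (- 0) (\<lambda>z. u z * v z)) \<le> K * (enn2real (I s1 0 u) * enn2real (I s2 b2 v))"
      using enn2real_mono[OF le] K(1) by (simp add: enn2real_mult)
    then have "sqrt (enn2real (I (- s0) (- 0) (\<lambda>z. u z * v z))) \<le> sqrt K * sqrt (enn2real (I s1 0 u)) * sqrt (enn2real (I s2 b2 v))"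
      using real_sqrt_le_mono by (fastforce simp: real_sqrt_mult mult.assoc)
    then show ?thesis
      by (simp only: hsb_norm_def I_def)
  qed
  then show ?thesis
    unfolding is_product_def by blast
qed

theorem theorem1:
  fixes s0 s1 s2 b2 :: real
  assumes "b2 > 1/2"
    and "s0 + s1 + s2 \<ge> 3/2"
    and "s0 + s1 + s2 \<ge> max s0 (max s1 s2)"
    and "\<not> (s0 + s1 + s2 = 3/2 \<and> s0 + s1 + s2 = max s0 (max s1 s2))"
  shows "is_product TYPE(3) s0 s1 s2 0 0 b2"
  using assms by (intro is_product_trivial_b) simp_all

end
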